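(* Let $p$ be an odd prime, let $\ell$ be a prime that does not divide $p-1$, and let $D$ be a central division algebra of degree $\ell$ over $\mathbb{Q}_p$. Then the profinite $p$-adic analytic group $\mathrm{SL}_1(D)$ is a CSA-group which is neither pro-$p$ nor abelian.
   Context: For a finite-dimensional central simple algebra $A$ over a field $K$, $\mathrm{SL}_1(A)$ denotes the group of elements of $A^\times$ of reduced norm $1$. A group is CA if the centralizer of every non-trivial element is abelian. A group is a CSA-group if it is CA and the centralizer of every non-trivial element is malnormal (a subgroup $C$ of $G$ is malnormal if $hCh^{-1}\cap C=\{1\}$ for every $h\in G\smallsetminus C$). *)

theory Defs
  imports "Jordan_Normal_Form.Char_Poly" "HOL-Computational_Algebra.Primes"
begin

definition padic_abs :: "nat \<Rightarrow> rat \<Rightarrow> real" where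
  "padic_abs p q =
     (if q = 0 then 0
      else (let (a, b) = quotient_of q
            in real p powr (real (multiplicity (int p) b) - real (multiplicity (int p) a))))"

definition is_abs_value :: "('k::field \<Rightarrow> real) \<Rightarrow> bool" where
  "is_abs_value v \<longleftrightarrow>
     (\<forall>x. v x \<ge> 0) \<and> (\<forall>x. v x = 0 \<longleftrightarrow> x = 0) \<and>
     (\<forall>x y. v (x * y) = v x * v y) \<and> (\<forall>x y. v (x + y) \<le> v x + v y)"

text \<open>K, with absolute value v, is a completion of Q with respect to the p-adic absolute value:
  v extends the p-adic absolute value, K is complete for v and Q is dense in K.
  This determines K up to isomorphism of valued fields, i.e. K is Q_p.\<close>
definition is_Qp :: "nat \<Rightarrow> ('k::field_char_0 \<Rightarrow> real) \<Rightarrow> bool" where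
  "is_Qp p v \<longleftrightarrow>
     is_abs_value v \<and>
     (\<forall>q. v (of_rat q) = padic_abs p q) \<and>
     (\<forall>x e. e > 0 \<longrightarrow> (\<exists>q. v (x - of_rat q) < e)) \<and>
     (\<forall>s :: nat \<Rightarrow> 'k.
        (\<forall>e>0. \<exists>N. \<forall>m\<ge>N. \<forall>n\<ge>N. v (s m - s n) < e) \<longrightarrow>
        (\<exists>L. \<forall>e>0. \<exists>N. \<forall>n\<ge>N. v (s n - L) < e))"

definition is_K_algebra :: "('k::field \<Rightarrow> 'd::division_ring \<Rightarrow> 'd) \<Rightarrow> bool" where
  "is_K_algebra sm \<longleftrightarrow>
     (\<forall>a x y. sm a (x + y) = sm a x + sm a y) \<and>
     (\<forall>a b x. sm (a + b) x = sm a x + sm b x) \<and>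
     (\<forall>a b x. sm (a * b) x = sm a (sm b x)) \<and>
     (\<forall>x. sm 1 x = x) \<and>
     (\<forall>a x y. sm a (x * y) = sm a x * y) \<and>
     (\<forall>a x y. sm a (x * y) = x * sm a y)"

definition center :: "'d::ring \<Rightarrow> bool" where
  "center z \<longleftrightarrow> (\<forall>x. z * x = x * z)"

definition is_central :: "('k::field \<Rightarrow> 'd::division_ring \<Rightarrow> 'd) \<Rightarrow> bool" where
  "is_central sm \<longleftrightarrow> (\<forall>z. center z \<longrightarrow> (\<exists>a. z = sm a 1))"

definition is_basis :: "('k::field \<Rightarrow> 'd::division_ring \<Rightarrow> 'd) \<Rightarrow> (nat \<Rightarrow> 'd) \<Rightarrow> nat \<Rightarrow> bool" where
  "is_basis sm b n \<longleftrightarrow>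
     (\<forall>x. \<exists>!c :: nat \<Rightarrow> 'k. (\<forall>i\<ge>n. c i = 0) \<and> x = (\<Sum>i<n. sm (c i) (b i)))"

definition coords :: "('k::field \<Rightarrow> 'd::division_ring \<Rightarrow> 'd) \<Rightarrow> (nat \<Rightarrow> 'd) \<Rightarrow> nat \<Rightarrow> 'd \<Rightarrow> nat \<Rightarrow> 'k" where
  "coords sm b n x = (THE c. (\<forall>i\<ge>n. c i = 0) \<and> x = (\<Sum>i<n. sm (c i) (b i)))"

definition lmult_mat :: "('k::field \<Rightarrow> 'd::division_ring \<Rightarrow> 'd) \<Rightarrow> (nat \<Rightarrow> 'd) \<Rightarrow> nat \<Rightarrow> 'd \<Rightarrow> 'k mat" where
  "lmult_mat sm b n x = mat n n (\<lambda>(i, j). coords sm b n (x * b j) i)"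

definition reduced_charpoly ::
  "('k::field \<Rightarrow> 'd::division_ring \<Rightarrow> 'd) \<Rightarrow> (nat \<Rightarrow> 'd) \<Rightarrow> nat \<Rightarrow> nat \<Rightarrow> 'd \<Rightarrow> 'k poly" where
  "reduced_charpoly sm b n d x =
     (THE f. lead_coeff f = 1 \<and> degree f = d \<and> f ^ d = char_poly (lmult_mat sm b n x))"

definition reduced_norm ::
  "('k::field \<Rightarrow> 'd::division_ring \<Rightarrow> 'd) \<Rightarrow> (nat \<Rightarrow> 'd) \<Rightarrow> nat \<Rightarrow> nat \<Rightarrow> 'd \<Rightarrow> 'k" where
  "reduced_norm sm b n d x = (-1) ^ d * coeff (reduced_charpoly sm b n d x) 0"

text \<open>SL_1(D) for D of degree d with basis b of length n = d^2.\<close>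
definition SL1 :: "('k::field \<Rightarrow> 'd::division_ring \<Rightarrow> 'd) \<Rightarrow> (nat \<Rightarrow> 'd) \<Rightarrow> nat \<Rightarrow> nat \<Rightarrow> 'd set" where
  "SL1 sm b n d = {x. reduced_norm sm b n d x = 1}"

definition centralizer :: "'d::division_ring set \<Rightarrow> 'd \<Rightarrow> 'd set" where
  "centralizer G x = {y \<in> G. y * x = x * y}"

definition is_abelian_set :: "'d::division_ring set \<Rightarrow> bool" where
  "is_abelian_set H \<longleftrightarrow> (\<forall>x\<in>H. \<forall>y\<in>H. x * y = y * x)"

definition malnormal :: "'d::division_ring set \<Rightarrow> 'd set \<Rightarrow> bool" where
  "malnormal G C \<longleftrightarrow> (\<forall>h \<in> G - C. {h * c * inverse h | c. c \<in> C} \<inter> C = {1})"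

definition CA_group :: "'d::division_ring set \<Rightarrow> bool" where
  "CA_group G \<longleftrightarrow> (\<forall>x\<in>G. x \<noteq> 1 \<longrightarrow> is_abelian_set (centralizer G x))"

definition CSA_group :: "'d::division_ring set \<Rightarrow> bool" where
  "CSA_group G \<longleftrightarrow> CA_group G \<and> (\<forall>x\<in>G. x \<noteq> 1 \<longrightarrow> malnormal G (centralizer G x))"

definition is_subgroup :: "'d::division_ring set \<Rightarrow> 'd set \<Rightarrow> bool" where
  "is_subgroup N G \<longleftrightarrow> N \<subseteq> G \<and> 1 \<in> N \<and> (\<forall>x\<in>N. \<forall>y\<in>N. x * y \<in> N) \<and> (\<forall>x\<in>N. inverse x \<in> N)"

definition is_normal_subgroup :: "'d::division_ring set \<Rightarrow> 'd set \<Rightarrow> bool" where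
  "is_normal_subgroup N G \<longleftrightarrow> is_subgroup N G \<and> (\<forall>g\<in>G. \<forall>x\<in>N. g * x * inverse g \<in> N)"

definition group_index :: "'d::division_ring set \<Rightarrow> 'd set \<Rightarrow> nat" where
  "group_index N G = card {{g * x | x. x \<in> N} | g. g \<in> G}"

section \<open>Topology on D induced from K (via a basis; independent of the basis)\<close>

definition D_norm ::
  "('k::field \<Rightarrow> real) \<Rightarrow> ('k \<Rightarrow> 'd::division_ring \<Rightarrow> 'd) \<Rightarrow> (nat \<Rightarrow> 'd) \<Rightarrow> nat \<Rightarrow> 'd \<Rightarrow> real" where
  "D_norm v sm b n x = Max (insert 0 {v (coords sm b n x i) | i. i < n})"

definition rel_open ::
  "('k::field \<Rightarrow> real) \<Rightarrow> ('k \<Rightarrow> 'd::division_ring \<Rightarrow> 'd) \<Rightarrow> (nat \<Rightarrow> 'd) \<Rightarrow> nat \<Rightarrow> 'd set \<Rightarrow> 'd set \<Rightarrow> bool" where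
  "rel_open v sm b n G U \<longleftrightarrow> U \<subseteq> G \<and>
     (\<forall>x\<in>U. \<exists>e>0. \<forall>y\<in>G. D_norm v sm b n (y - x) < e \<longrightarrow> y \<in> U)"

definition is_pro_p ::
  "nat \<Rightarrow> ('k::field \<Rightarrow> real) \<Rightarrow> ('k \<Rightarrow> 'd::division_ring \<Rightarrow> 'd) \<Rightarrow> (nat \<Rightarrow> 'd) \<Rightarrow> nat \<Rightarrow> 'd set \<Rightarrow> bool" where
  "is_pro_p p v sm b n G \<longleftrightarrow>
     (\<forall>N. is_normal_subgroup N G \<and> rel_open v sm b n G N \<longrightarrow> (\<exists>k. group_index N G = p ^ k))"

end

(*
Put n = l^2, let det x be the determinant of left multiplication by x on D, and let C(x) be the
centralizer of x in D.  The characteristic polynomial of left multiplication by x is a power of the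
minimal polynomial of x, so Nrd(x)^l = det x.  As Q_p contains no l-th root of unity other than 1,
SL_1(D) = {x. det x = 1}, and its only central element is 1.

Algebraic part.  By the tower law C(x) has dimension l for noncentral x, and C(x) is commutative.
If h in SL_1(D) normalizes L = C(x) and is not in L, then Artin's independence argument gives
0 < m <= l such that h^m commutes with L; hence h^m is central, so h^m = 1, and 1 + h + ... + h^(m-1) = 0
contradicts that h has degree l.  If SL_1(D) were abelian, then C(c) would be normalized by D^* for a
commutator c, and comparing the conjugates of c by h and by 1 + h would make D commutative.

Arithmetic part.  By compactness w(x) = |det x| satisfies w(x + y) <= A max (w x) (w y), and expanding
(1 + x)^N shows that A = 1 will do.  Since D is not commutative, some x with w(x) = 1 is not congruent
to an integer modulo {w < 1}.  Its Teichmueller lift u has order prime to p, so det u is a (p-1)-st root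
of unity and g = u^(p-1) lies in SL_1(D), with w(g - 1) = 1.  The open normal subgroup
{x. w(x - 1) < 1} would have to contain g if its index were a power of p.
*)
theory Submission
  imports Defs "HOL-Computational_Algebra.Polynomial_Factorial"
    "HOL-Analysis.Abstract_Metric_Spaces" "HOL-Number_Theory.Residues"
    "HOL-Real_Asymp.Real_Asymp"
begin

hide_const (open) up_ring.coeff up_ring.monom Convex_Euclidean_Space.rel_open Finite_Cartesian_Product.mat

section \<open>Linear algebra in a division algebra\<close>

text \<open>\<open>reduced_norm\<close> is picked out by a description for each element separately,
  so its multiplicativity is not visible; the determinant is multiplicative at once, which is why it
  takes over. The conditions that p is odd and that l does not divide p - 1 enter through the l-th
  roots of unity: a root z other than 1 in Q_p would be a central element of reduced norm z^l = 1,
  whose centralizer is the whole non-abelian group. The arithmetic part replaces the structure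
  theory of D (extension of valuations, unramified subfields, Hensel's lemma) by continuity of the
  determinant and compactness of bounded sets. The exponent p - 1 does two things. A root of unity
  in Q_p of order prime to p has order dividing p - 1, so det u becomes trivial; and the residues of
  1, ..., p - 1 exhaust the roots of X^(p-1) - 1, so g stays away from 1 because u is not congruent
  to an integer. Such a g obstructs the pro-p property because the quotient of the integral elements
  by {w < 1} has characteristic p and no nilpotents, hence no units of order p.\<close>

locale division_algebra =
  fixes sm :: "'k::field \<Rightarrow> 'd::division_ring \<Rightarrow> 'd" and b :: "nat \<Rightarrow> 'd" and n :: nat
  assumes alg: "is_K_algebra sm" and basis: "is_basis sm b n"
begin

lemmas sm_add_right = alg[unfolded is_K_algebra_def, THEN conjunct1, rule_format]
lemmas sm_add_left = alg[unfolded is_K_algebra_def, THEN conjunct2, THEN conjunct1, rule_format]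
lemmas sm_sm = alg[unfolded is_K_algebra_def, THEN conjunct2, THEN conjunct2, THEN conjunct1, rule_format]
lemmas sm_one = alg[unfolded is_K_algebra_def, THEN conjunct2, THEN conjunct2, THEN conjunct2, THEN conjunct1, rule_format]
lemmas sm_mult_left = alg[unfolded is_K_algebra_def, THEN conjunct2, THEN conjunct2, THEN conjunct2, THEN conjunct2, THEN conjunct1, rule_format, symmetric]
lemmas sm_mult_right = alg[unfolded is_K_algebra_def, THEN conjunct2, THEN conjunct2, THEN conjunct2, THEN conjunct2, THEN conjunct2, rule_format, symmetric]

sublocale V: vector_space sm
  by unfold_locales (auto simp: sm_add_right sm_add_left sm_sm sm_one)

lemma sm_one_mult: "sm a 1 * x = sm a x" "x * sm a 1 = sm a x"
  by (simp_all add: sm_mult_left sm_mult_right)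

lemma sm_of_nat: "sm (of_nat k) 1 = of_nat k"
  by (induction k) (auto simp: sm_one sm_add_left)

lemma sm_of_int: "sm (of_int k) 1 = of_int k"
  by (cases k) (auto simp: sm_of_nat V.scale_left_diff_distrib sm_one sm_add_left simp del: of_nat_Suc)

lemma coords_props:
  "(\<forall>i\<ge>n. coords sm b n x i = 0) \<and> x = (\<Sum>i<n. sm (coords sm b n x i) (b i))"
  unfolding coords_def by (rule theI'[OF basis[unfolded is_basis_def, rule_format]])

lemma coords_ge: "i \<ge> n \<Longrightarrow> coords sm b n x i = 0"
  using coords_props by blast

lemma coords_sum: "(\<Sum>i<n. sm (coords sm b n x i) (b i)) = x"
  using coords_props by metis

lemma coords_unique:
  assumes "\<And>i. i \<ge> n \<Longrightarrow> c i = 0" and "x = (\<Sum>i<n. sm (c i) (b i))"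
  shows "coords sm b n x = c"
  unfolding coords_def by (rule the1_equality[OF basis[unfolded is_basis_def, rule_format]]) (use assms in auto)

lemma coords_add: "coords sm b n (x + y) = (\<lambda>i. coords sm b n x i + coords sm b n y i)"
  by (rule coords_unique) (auto simp: coords_ge sm_add_left sum.distrib coords_sum)

lemma coords_sm: "coords sm b n (sm a x) = (\<lambda>i. a * coords sm b n x i)"
  by (rule coords_unique) (simp add: coords_ge, simp only: sm_sm V.scale_sum_right[symmetric] coords_sum)

lemma coords_zero: "coords sm b n 0 = (\<lambda>i. 0)"
  by (rule coords_unique) auto

lemma coords_sum_fun:
  "finite A \<Longrightarrow> coords sm b n (\<Sum>x\<in>A. f x) i = (\<Sum>x\<in>A. coords sm b n (f x) i)"
  by (induction A rule: finite_induct) (auto simp: coords_zero coords_add)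

lemma coords_combination: "coords sm b n (\<Sum>i<n. sm (c i) (b i)) = (\<lambda>i. if i < n then c i else 0)"
  by (rule coords_unique) auto

lemma coords_basis: "j < n \<Longrightarrow> coords sm b n (b j) = (\<lambda>i. if i = j then 1 else 0)"
  by (rule coords_unique)
    (auto simp: if_distrib[of "\<lambda>a. sm a _"] if_distribR sm_one cong: if_cong)

lemma basis_inj: "inj_on b {..<n}"
proof
  fix i j assume ij: "i \<in> {..<n}" "j \<in> {..<n}" "b i = b j"
  then have "(\<lambda>k. if k = i then 1 else 0 :: 'k) = (\<lambda>k. if k = j then 1 else 0)"
    using coords_basis[of i] coords_basis[of j] by simp
  then show "i = j" by (metis zero_neq_one)
qed

lemma basis_span: "V.span (b ` {..<n}) = UNIV"
proof -
  have "x \<in> V.span (b ` {..<n})" for x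
    by (subst coords_sum[symmetric]) (intro V.span_sum V.span_scale V.span_base imageI)
  then show ?thesis by auto
qed

lemma basis_independent: "V.independent (b ` {..<n})"
proof (subst V.independent_explicit_finite_subsets, intro allI impI ballI)
  fix A u a
  assume A: "A \<subseteq> b ` {..<n}" "finite A" "(\<Sum>a\<in>A. sm (u a) a) = 0" "a \<in> A"
  define c where "c i = (if b i \<in> A then u (b i) else 0)" for i
  have "(\<Sum>i<n. sm (c i) (b i)) = (\<Sum>x\<in>b ` {..<n}. sm (if x \<in> A then u x else 0) x)"
    by (subst sum.reindex[OF basis_inj]) (simp add: c_def)
  also have "\<dots> = (\<Sum>x\<in>A. sm (u x) x)"
    using A by (intro sum.mono_neutral_cong_right) auto
  finally have "coords sm b n 0 = (\<lambda>i. if i < n then c i else 0)"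
    using coords_combination[of c] A by simp
  moreover obtain i where "i < n" "a = b i" using A by auto
  ultimately show "u a = 0" using A by (metis (mono_tags) c_def coords_zero)
qed

sublocale V: finite_dimensional_vector_space sm "b ` {..<n}"
  by unfold_locales (auto simp: basis_independent basis_span)

lemma dim_UNIV: "V.dim UNIV = n"
  by (simp add: card_image basis_inj)

lemma linear_mult: "Vector_Spaces.linear sm sm (\<lambda>x. a * x)" "Vector_Spaces.linear sm sm (\<lambda>x. x * a)"
  by unfold_locales (auto simp: algebra_simps sm_mult_left sm_mult_right)

section \<open>Division subalgebras and the tower law\<close>

definition subdiv :: "'d set \<Rightarrow> bool" where
  "subdiv S \<longleftrightarrow> V.subspace S \<and> 1 \<in> S \<and> (\<forall>x\<in>S. \<forall>y\<in>S. x * y \<in> S) \<and> (\<forall>x\<in>S. inverse x \<in> S)"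

sublocale VV: finite_dimensional_vector_space_pair_1 sm "b ` {..<n}" sm
  by unfold_locales

lemma dim_image_mult:
  assumes "e \<noteq> 0" shows "V.dim ((\<lambda>s. s * e) ` S) = V.dim S" "V.dim ((\<lambda>s. e * s) ` S) = V.dim S"
  using assms by (auto intro!: VV.dim_image_eq linear_mult inj_onI)

text \<open>A stable subspace of maximal dimension among those whose dimension is a multiple of \<open>dim S\<close>
  is all of \<open>W\<close>.\<close>
lemma dim_subdiv_dvd:
  assumes S: "subdiv S" and W: "V.subspace W" "\<And>s w. s \<in> S \<Longrightarrow> w \<in> W \<Longrightarrow> s * w \<in> W"
  shows "V.dim S dvd V.dim W"
proof -
  define P where "P U \<longleftrightarrow> V.subspace U \<and> U \<subseteq> W \<and> (\<forall>s\<in>S. \<forall>u\<in>U. s * u \<in> U) \<and> V.dim S dvd V.dim U" for U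
  have "V.dim {0} = 0" by simp
  then have "P {0}" using W V.subspace_0 unfolding P_def by auto
  moreover have "\<forall>U. P U \<longrightarrow> V.dim U < Suc (V.dim W)"
    unfolding P_def by (auto simp: less_Suc_eq_le V.dim_subset)
  ultimately obtain U where U: "P U" and max: "\<And>U'. P U' \<Longrightarrow> V.dim U' \<le> V.dim U"
    using ex_has_greatest_nat[of P "{0}" V.dim] by blast
  have "W \<subseteq> U"
  proof (rule ccontr)
    assume "\<not> W \<subseteq> U"
    then obtain e where e: "e \<in> W" "e \<notin> U" by auto
    have sS: "V.subspace S" using S by (simp add: subdiv_def)
    have sU: "V.subspace U" using U by (simp add: P_def)
    have e0: "e \<noteq> 0" using e sU V.subspace_0 by auto
    let ?Se = "(\<lambda>s. s * e) ` S"
    have sSe: "V.subspace ?Se"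
      by (rule VV.linear_subspace_image[OF linear_mult(2) sS])
    \<comment> \<open>Adjoining the copy S e of S keeps stability and adds \<open>dim S\<close> to
      the dimension: the sum is direct, since s e in U with s nonzero would put e itself in
      U.\<close>
    define U' where "U' = {x + y |x y. x \<in> U \<and> y \<in> ?Se}"
    have "U \<inter> ?Se \<subseteq> {0}"
    proof
      fix x assume x: "x \<in> U \<inter> ?Se"
      then obtain s where s: "s \<in> S" "x = s * e" by auto
      show "x \<in> {0}"
      proof (rule ccontr)
        assume "x \<notin> {0}"
        then have "s \<noteq> 0" using s by auto
        moreover have "inverse s * x \<in> U" using S s U x unfolding P_def subdiv_def by auto
        ultimately show False using s e by (simp add: mult.assoc[symmetric])
      qed
    qed
    then have "V.dim (U \<inter> ?Se) = 0" by simp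
    then have dim: "V.dim U' = V.dim U + V.dim S"
      using V.dim_sums_Int[OF sU sSe] dim_image_mult(1)[OF e0, of S] unfolding U'_def by linarith
    have "P U'"
      unfolding P_def
    proof (intro conjI ballI)
      show "V.subspace U'" unfolding U'_def by (rule V.subspace_sums[OF sU sSe])
      show "U' \<subseteq> W" unfolding U'_def using U W e by (auto simp: P_def intro!: V.subspace_add)
      show "V.dim S dvd V.dim U'" using U by (simp add: dim P_def)
      fix s u assume su: "s \<in> S" "u \<in> U'"
      then obtain x t where "x \<in> U" "t \<in> S" "u = x + t * e" unfolding U'_def by auto
      moreover from this su have "s * x \<in> U" "s * t \<in> S" using U S by (auto simp: P_def subdiv_def)
      ultimately show "s * u \<in> U'" unfolding U'_def
        by (auto simp: distrib_left mult.assoc[symmetric])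
    qed
    from max[OF this] dim have "V.dim S = 0" by simp
    then show False using S by (auto simp: subdiv_def)
  qed
  then show ?thesis using U unfolding P_def by (metis subset_antisym)
qed

text \<open>Left multiplication by a nonzero z in E is an injective linear map of the
  finite-dimensional E into itself, hence onto, so 1 = z y for some y in E.\<close>

lemma subdiv_if_closed_mult:
  assumes E: "V.subspace E" "1 \<in> E" "\<And>x y. x \<in> E \<Longrightarrow> y \<in> E \<Longrightarrow> x * y \<in> E"
  shows "subdiv E"
  unfolding subdiv_def
proof (intro conjI ballI)
  fix z assume z: "z \<in> E"
  show "inverse z \<in> E"
  proof (cases "z = 0")
    case False
    have "V.subspace ((\<lambda>y. z * y) ` E)"
      by (rule VV.linear_subspace_image[OF linear_mult(1) E(1)])
    moreover have "(\<lambda>y. z * y) ` E \<subseteq> E" using E z by auto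
    ultimately have "(\<lambda>y. z * y) ` E = E"
      using V.subspace_dim_equal E(1) dim_image_mult(2)[OF False, of E] by (metis order_refl)
    then obtain y where "y \<in> E" "z * y = 1" using E(2) by (metis imageE)
    then show ?thesis by (metis inverse_unique)
  qed (use z in simp)
qed (use E in auto)

section \<open>The commutative subalgebra generated by one element\<close>

definition powers :: "'d \<Rightarrow> nat \<Rightarrow> 'd set" where
  "powers x m = V.span ((\<lambda>i. x ^ i) ` {..<m})"

definition generated :: "'d \<Rightarrow> 'd set" where
  "generated x = V.span (range (\<lambda>i. x ^ i))"

lemma commute_span:
  assumes "y \<in> V.span B" "\<And>z. z \<in> B \<Longrightarrow> x * z = z * x"
  shows "x * y = y * x"
  using assms(1)
  by (induction rule: V.span_induct_alt)
     (auto simp: algebra_simps sm_mult_left sm_mult_right assms(2))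

lemma generated_commute:
  assumes "y \<in> generated x" and "z \<in> generated x"
  shows "y * z = z * y"
proof -
  have *: "x ^ i * z = z * x ^ i" for i
    using assms(2) unfolding generated_def
    by (rule commute_span) (auto simp: power_add[symmetric] add.commute)
  have "z * y = y * z"
    using assms(1) unfolding generated_def by (rule commute_span) (use * in auto)
  then show ?thesis ..
qed

lemma subdiv_generated: "subdiv (generated x)"
proof (rule subdiv_if_closed_mult)
  show "V.subspace (generated x)" unfolding generated_def by simp
  show "1 \<in> generated x" unfolding generated_def by (rule V.span_base) (metis power_0 rangeI)
  fix y z assume y: "y \<in> generated x" and z: "z \<in> generated x"
  have *: "x ^ i * z \<in> generated x" for i
    using z unfolding generated_def
  proof (induction rule: V.span_induct_alt)
    case (step c u w)
    then obtain j where "u = x ^ j" by auto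
    then have "x ^ i * u \<in> range (\<lambda>i. x ^ i)" by (auto simp: power_add[symmetric])
    with step show ?case
      by (simp add: distrib_left sm_mult_right V.span_add V.span_base V.span_scale)
  qed (simp add: V.span_zero)
  show "y * z \<in> generated x"
    using y unfolding generated_def
  proof (induction rule: V.span_induct_alt)
    case (step c u w)
    with * show ?case
      by (auto simp: distrib_right sm_mult_left V.span_add V.span_scale generated_def)
  qed (simp add: V.span_zero)
qed

lemma powers_dim:
  assumes "\<And>j. j < m \<Longrightarrow> x ^ j \<notin> powers x j"
  shows "V.dim (powers x m) = m"
  using assms
proof (induction m)
  case (Suc m)
  have "x ^ m \<notin> V.span ((\<lambda>i. x ^ i) ` {..<m})" using Suc.prems[of m] by (simp add: powers_def)
  then show ?case using Suc unfolding powers_def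
    by (simp add: lessThan_Suc V.dim_insert)
qed (simp add: powers_def)

text \<open>The assumption expresses a monic equation of degree m for x. It makes the span of the
  first m powers stable under multiplication by x, so that all further powers stay inside.\<close>

lemma generated_eq_powers:
  assumes "x ^ m \<in> powers x m"
  shows "generated x = powers x m"
proof
  show "powers x m \<subseteq> generated x" unfolding powers_def generated_def by (rule V.span_mono) auto
  have "m \<noteq> 0"
  proof
    assume "m = 0"
    with assms show False by (simp add: powers_def)
  qed
  then have one: "1 \<in> powers x m" unfolding powers_def by (intro V.span_base) (force intro: image_eqI[of _ _ 0])
  have step: "x * y \<in> powers x m" if "y \<in> powers x m" for y
    using that unfolding powers_def
  proof (induction rule: V.span_induct_alt)
    case (step c u w)
    then obtain j where j: "u = x ^ j" "j < m" by auto
    have "x * u \<in> powers x m"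
    proof (cases "Suc j = m")
      case True then show ?thesis using assms j by (metis power_Suc)
    next
      case False then show ?thesis using j unfolding powers_def
        by (intro V.span_base) (force intro: image_eqI[of _ _ "Suc j"])
    qed
    with step show ?case
      by (simp add: distrib_left sm_mult_right V.span_add V.span_scale powers_def)
  qed (simp add: V.span_zero)
  have "x ^ i \<in> powers x m" for i by (induction i) (auto simp: one step)
  then show "generated x \<subseteq> powers x m" unfolding generated_def powers_def
    by (intro V.span_minimal) auto
qed

lemma dim_generated_le:
  assumes "x ^ m \<in> powers x m"
  shows "V.dim (generated x) \<le> m"
proof -
  have "V.dim (powers x m) \<le> card ((\<lambda>i. x ^ i) ` {..<m})"
    unfolding powers_def by (rule V.dim_le_card) auto
  also have "\<dots> \<le> m" by (metis card_image_le card_lessThan finite_lessThan)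
  finally show ?thesis using generated_eq_powers[OF assms] by simp
qed

lemma ex_power_dependent: "\<exists>m\<le>n. x ^ m \<in> powers x m"
proof (rule ccontr)
  assume "\<not> ?thesis"
  then have "V.dim (powers x (Suc n)) = Suc n" by (intro powers_dim) auto
  moreover have "V.dim (powers x (Suc n)) \<le> n" using V.dim_subset[OF subset_UNIV] dim_UNIV by metis
  ultimately show False by simp
qed

lemma x_mem_generated: "x \<in> generated x"
  unfolding generated_def by (rule V.span_base) (metis power_one_right rangeI)

lemma dim_one_iff_scalar:
  assumes S: "subdiv S" and dim: "V.dim S = 1" and x: "x \<in> S"
  shows "\<exists>a. x = sm a 1"
proof -
  have "V.span {1} \<subseteq> S" by (rule V.span_minimal) (use S in \<open>auto simp: subdiv_def\<close>)
  moreover have "V.dim (V.span {1}) = 1" by (simp add: V.dim_insert)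
  ultimately have "V.span {1} = S"
    using V.subspace_dim_equal[of "V.span {1}" S] S dim by (auto simp: subdiv_def)
  then show ?thesis using x by (auto simp: V.span_singleton)
qed

end

section \<open>Characteristic polynomials\<close>

text \<open>Each factor q of the power divides a or its cofactor and can be cancelled there. This
  will be applied to the characteristic polynomial as a divisor of a power of the minimal
  polynomial.\<close>

lemma dvd_prime_elem_power:
  fixes q :: "'a::algebraic_semidom"
  assumes "prime_elem q" and "a dvd q ^ N"
  shows "\<exists>u k. is_unit u \<and> a = u * q ^ k"
  using assms(2)
proof (induction N arbitrary: a)
  case 0
  then show ?case by (intro exI[of _ a] exI[of _ 0]) auto
next
  case (Suc N)
  have q: "q \<noteq> 0" using assms(1) by auto
  obtain c where c: "q ^ Suc N = a * c" using Suc.prems by auto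
  then have "q dvd a * c" by (metis dvd_triv_left power_Suc)
  then consider "q dvd a" | "q dvd c" using assms(1) prime_elem_dvd_multD by blast
  then show ?case
  proof cases
    case 1
    then obtain a' where a': "a = q * a'" by auto
    then have "q ^ N = a' * c" using c q by (simp add: mult.assoc)
    then obtain u k where "is_unit u" "a' = u * q ^ k" using Suc.IH[of a'] by auto
    then show ?thesis using a' by (intro exI[of _ u] exI[of _ "Suc k"]) (simp add: mult.left_commute)
  next
    case 2
    then obtain c' where "c = q * c'" by auto
    then have "q * q ^ N = q * (a * c')" using c by (simp add: mult.left_commute)
    then have "q ^ N = a * c'" using q by simp
    then show ?thesis using Suc.IH by auto
  qed
qed

text \<open>Factor f^l - g^l as (f - g) s. The l summands of s are monic of the same degree, so s
  has the coefficient l there, which is nonzero in characteristic 0. This yields the uniqueness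
  required by the description in \<open>reduced_charpoly\<close>.\<close>

lemma monic_power_inject:
  fixes f g :: "'a::field_char_0 poly"
  assumes monic: "lead_coeff f = 1" "lead_coeff g = 1" and l: "l > 0" and eq: "f ^ l = g ^ l"
  shows "f = g"
proof -
  have "f \<noteq> 0" "g \<noteq> 0" using monic by auto
  then have "degree (f ^ l) = l * degree f" "degree (g ^ l) = l * degree g"
    by (simp_all add: degree_power_eq)
  then have deg: "degree f = degree g" using eq l by simp
  define s where "s = (\<Sum>i<l. g ^ (l - Suc i) * f ^ i)"
  have "coeff (g ^ (l - Suc i) * f ^ i) ((l - 1) * degree g) = 1" if "i < l" for i
  proof -
    have "lead_coeff (g ^ (l - Suc i) * f ^ i) = 1"
      by (simp add: lead_coeff_mult lead_coeff_power monic)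
    moreover have "degree (g ^ (l - Suc i) * f ^ i) = (l - Suc i) * degree g + i * degree g"
      using \<open>f \<noteq> 0\<close> \<open>g \<noteq> 0\<close> deg by (simp add: degree_mult_eq degree_power_eq)
    moreover have "(l - Suc i) * degree g + i * degree g = (l - 1) * degree g"
      using that by (simp add: add_mult_distrib[symmetric])
    ultimately show ?thesis by metis
  qed
  then have "coeff s ((l - 1) * degree g) = of_nat l" unfolding s_def by (simp add: coeff_sum)
  then have "s \<noteq> 0" using l by auto
  moreover have "(f - g) * s = 0"
    using power_diff_sumr2[of f l g] eq unfolding s_def by simp
  ultimately show ?thesis by simp
qed

lemma pCons_sum_mult: "[:\<Sum>k<N. u k * w k:] = (\<Sum>k<N. [:u k:] * [:w k:])"
  for u w :: "nat \<Rightarrow> 'a::comm_ring_1"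
  by (rule poly_eqI) (simp add: coeff_sum coeff_pCons mult.commute split: nat.split)

context division_algebra
begin

lemma n_pos: "n > 0"
proof (rule ccontr)
  assume "\<not> n > 0"
  then have "(1::'d) = 0" using coords_sum[of 1] by simp
  then show False by simp
qed

section \<open>The matrix of left multiplication and its determinant\<close>

lemma lmult_carrier [simp]: "lmult_mat sm b n x \<in> carrier_mat n n"
  by (simp add: lmult_mat_def)

lemma lmult_dim [simp]: "dim_row (lmult_mat sm b n x) = n" "dim_col (lmult_mat sm b n x) = n"
  by (simp_all add: lmult_mat_def)

lemma lmult_index: "i < n \<Longrightarrow> j < n \<Longrightarrow> lmult_mat sm b n x $$ (i, j) = coords sm b n (x * b j) i"
  by (simp add: lmult_mat_def)

lemma coords_mult:
  "coords sm b n (x * y) i = (\<Sum>k<n. coords sm b n y k * coords sm b n (x * b k) i)"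
proof -
  have "x * y = x * (\<Sum>k<n. sm (coords sm b n y k) (b k))" by (simp only: coords_sum)
  also have "\<dots> = (\<Sum>k<n. sm (coords sm b n y k) (x * b k))"
    by (simp add: sum_distrib_left sm_mult_right)
  finally show ?thesis by (simp add: coords_sum_fun coords_sm)
qed

lemma lmult_mult_index:
  assumes "i < n" "j < n"
  shows "lmult_mat sm b n (x * y) $$ (i, j) =
    (\<Sum>k<n. lmult_mat sm b n x $$ (i, k) * lmult_mat sm b n y $$ (k, j))"
  using assms by (simp add: lmult_index mult.assoc coords_mult[of x "y * b j"] mult.commute)

lemma lmult_mult: "lmult_mat sm b n (x * y) = lmult_mat sm b n x * lmult_mat sm b n y"
proof (rule eq_matI)
  fix i j assume "i < dim_row (lmult_mat sm b n x * lmult_mat sm b n y)"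
    "j < dim_col (lmult_mat sm b n x * lmult_mat sm b n y)"
  then have ij: "i < n" "j < n" by auto
  then have "(lmult_mat sm b n x * lmult_mat sm b n y) $$ (i, j) =
    (\<Sum>k = 0..<n. lmult_mat sm b n x $$ (i, k) * lmult_mat sm b n y $$ (k, j))"
    by (simp add: scalar_prod_def)
  then show "lmult_mat sm b n (x * y) $$ (i, j) = (lmult_mat sm b n x * lmult_mat sm b n y) $$ (i, j)"
    by (simp only: lmult_mult_index[OF ij] atLeast0LessThan)
qed auto

lemma lmult_add_index:
  assumes "i < n" "j < n"
  shows "lmult_mat sm b n (x + y) $$ (i, j) = lmult_mat sm b n x $$ (i, j) + lmult_mat sm b n y $$ (i, j)"
  using assms by (simp add: lmult_index distrib_right coords_add)

lemma lmult_scalar_index: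
  assumes "i < n" "j < n"
  shows "lmult_mat sm b n (sm a 1) $$ (i, j) = (if i = j then a else 0)"
  using assms by (simp add: lmult_index sm_one_mult coords_sm coords_basis)

lemma lmult_scalar: "lmult_mat sm b n (sm a 1) = a \<cdot>\<^sub>m 1\<^sub>m n"
  by (rule eq_matI) (auto simp: lmult_scalar_index)

definition nrm :: "'d \<Rightarrow> 'k" where
  "nrm x = det (lmult_mat sm b n x)"

lemma nrm_mult: "nrm (x * y) = nrm x * nrm y"
  unfolding nrm_def lmult_mult by (rule det_mult[OF lmult_carrier lmult_carrier])

lemma nrm_scalar: "nrm (sm a 1) = a ^ n"
  unfolding nrm_def lmult_scalar by simp

lemma nrm_sm: "nrm (sm a x) = a ^ n * nrm x"
  by (metis nrm_mult nrm_scalar sm_one_mult(1))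

lemma nrm_one [simp]: "nrm 1 = 1"
  using nrm_scalar[of 1] by (simp add: sm_one)

lemma nrm_zero [simp]: "nrm 0 = 0"
  using nrm_scalar[of 0] n_pos by simp

lemma nrm_power: "nrm (x ^ k) = nrm x ^ k"
  by (induction k) (auto simp: nrm_mult)

lemma nrm_inverse: "nrm (inverse x) = inverse (nrm x)"
proof (cases "x = 0")
  case False
  then have "nrm x * nrm (inverse x) = 1" by (simp flip: nrm_mult)
  then show ?thesis by (rule inverse_unique[symmetric])
qed simp

lemma nrm_eq_0_iff [simp]: "nrm x = 0 \<longleftrightarrow> x = 0"
proof
  assume "nrm x = 0"
  moreover have "nrm x * nrm (inverse x) = 1" if "x \<noteq> 0" using that by (simp flip: nrm_mult)
  ultimately show "x = 0" by fastforce
qed simp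

section \<open>Evaluation of polynomials in D and minimal polynomials\<close>

definition ev :: "'d \<Rightarrow> 'k poly \<Rightarrow> 'd" where
  "ev x f = fold_coeffs (\<lambda>a y. sm a 1 + x * y) f 0"

lemma ev_0 [simp]: "ev x 0 = 0"
  by (simp add: ev_def)

lemma ev_pCons: "ev x (pCons a f) = sm a 1 + x * ev x f"
  by (cases "f = 0 \<and> a = 0") (auto simp: ev_def)

lemma ev_add: "ev x (f + g) = ev x f + ev x g"
  by (induction f g rule: poly_induct2) (auto simp: ev_pCons sm_add_left algebra_simps)

lemma ev_smult: "ev x (Polynomial.smult a f) = sm a (ev x f)"
  by (induction f) (simp_all add: ev_pCons sm_add_right sm_sm[symmetric] sm_mult_right)

text \<open>The coefficients act as central elements, so evaluation is a ring homomorphism although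
  D is not commutative.\<close>

lemma ev_mult: "ev x (f * g) = ev x f * ev x g"
  by (induction f) (auto simp: ev_pCons ev_add ev_smult distrib_right sm_one_mult mult.assoc)

lemma ev_monom: "ev x (monom a i) = sm a (x ^ i)"
  by (induction i) (auto simp: ev_pCons monom_0 monom_Suc sm_mult_right)

lemma ev_sum: "ev x (\<Sum>i\<in>A. f i) = (\<Sum>i\<in>A. ev x (f i))"
  by (induction A rule: infinite_finite_induct) (auto simp: ev_add)

lemma ev_altdef: "degree f < m \<Longrightarrow> ev x f = (\<Sum>i<m. sm (coeff f i) (x ^ i))"
  by (subst poly_as_sum_of_monoms'[of f "m - 1", symmetric])
     (auto simp: ev_sum ev_monom simp flip: lessThan_Suc_atMost)

text \<open>With A the matrix of x this is the identity (X - A) B + f(A) = f over polynomial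
  matrices, written in entries. One Horner step preserves it: (X - A) (X B + f(A)) + (a + A f(A)) =
  a + X f.\<close>

lemma ex_char_poly_cofactor:
  "\<exists>B. \<forall>i<n. \<forall>j<n. [:0, 1:] * B i j - (\<Sum>k<n. [:lmult_mat sm b n x $$ (i, k):] * B k j)
     + [:lmult_mat sm b n (ev x f) $$ (i, j):] = (if i = j then f else 0)"
proof (induction f)
  case 0
  have "lmult_mat sm b n 0 $$ (i, j) = 0" if "i < n" "j < n" for i j
    using that by (simp add: lmult_index coords_zero)
  then show ?case by (intro exI[of _ "\<lambda>i j. 0"]) auto
next
  case (pCons a f)
  let ?A = "\<lambda>i j. [:lmult_mat sm b n x $$ (i, j):]"
  let ?F = "\<lambda>i j. [:lmult_mat sm b n (ev x f) $$ (i, j):]"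
  obtain B where B: "[:0, 1:] * B i j - (\<Sum>k<n. ?A i k * B k j) + ?F i j = (if i = j then f else 0)"
    if "i < n" "j < n" for i j
    using pCons.IH by blast
  define B' where "B' i j = [:0, 1:] * B i j + ?F i j" for i j
  show ?case
  proof (intro exI[of _ B'] allI impI)
    fix i j assume ij: "i < n" "j < n"
    have F1: "lmult_mat sm b n (ev x (pCons a f)) $$ (i, j) =
      (if i = j then a else 0) + (\<Sum>k<n. lmult_mat sm b n x $$ (i, k) * lmult_mat sm b n (ev x f) $$ (k, j))"
      using ij by (simp only: ev_pCons lmult_add_index lmult_mult_index lmult_scalar_index)
    have F2: "[:\<Sum>k<n. lmult_mat sm b n x $$ (i, k) * lmult_mat sm b n (ev x f) $$ (k, j):] =
      (\<Sum>k<n. ?A i k * ?F k j)"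
      by (rule pCons_sum_mult)
    have F: "[:lmult_mat sm b n (ev x (pCons a f)) $$ (i, j):] =
      [:if i = j then a else 0:] + (\<Sum>k<n. ?A i k * ?F k j)"
      unfolding F1 F2[symmetric] by simp
    have S: "(\<Sum>k<n. ?A i k * B' k j) = [:0, 1:] * (\<Sum>k<n. ?A i k * B k j) + (\<Sum>k<n. ?A i k * ?F k j)"
      unfolding B'_def by (simp only: distrib_left sum.distrib sum_distrib_left mult.left_commute)
    have "[:0, 1:] * B' i j - (\<Sum>k<n. ?A i k * B' k j) + [:lmult_mat sm b n (ev x (pCons a f)) $$ (i, j):]
      = [:0, 1:] * ([:0, 1:] * B i j - (\<Sum>k<n. ?A i k * B k j) + ?F i j) + [:if i = j then a else 0:]"
      unfolding F S by (simp only: B'_def algebra_simps)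
    also have "\<dots> = (if i = j then pCons a f else 0)"
      unfolding B[OF ij] by simp
    finally show "[:0, 1:] * B' i j - (\<Sum>k<n. ?A i k * B' k j)
      + [:lmult_mat sm b n (ev x (pCons a f)) $$ (i, j):] = (if i = j then pCons a f else 0)" .
  qed
qed

text \<open>Modulo the matrix \<open>X - A\<close> a polynomial \<open>f\<close> is congruent to \<open>f(A)\<close>; taking determinants when
  \<open>f(A) = 0\<close> avoids both Cayley--Hamilton and a choice of basis adapted to \<open>K(x)\<close>.\<close>
lemma char_poly_dvd_power:
  assumes "ev x f = 0"
  shows "char_poly (lmult_mat sm b n x) dvd f ^ n"
proof -
  obtain B where B: "[:0, 1:] * B i j - (\<Sum>k<n. [:lmult_mat sm b n x $$ (i, k):] * B k j)
     + [:lmult_mat sm b n (ev x f) $$ (i, j):] = (if i = j then f else 0)" if "i < n" "j < n" for i j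
    using ex_char_poly_cofactor[of x f] by blast
  define C where "C = char_poly_matrix (lmult_mat sm b n x)"
  have C: "C \<in> carrier_mat n n" unfolding C_def by simp
  define BM where "BM = mat n n (\<lambda>(i, j). B i j)"
  have "C * BM = f \<cdot>\<^sub>m 1\<^sub>m n"
  proof (rule eq_matI)
    fix i j assume "i < dim_row (f \<cdot>\<^sub>m 1\<^sub>m n)" "j < dim_col (f \<cdot>\<^sub>m 1\<^sub>m n)"
    then have ij: "i < n" "j < n" by auto
    have "lmult_mat sm b n (ev x f) $$ (i, j) = 0"
      using ij by (simp add: assms lmult_index coords_zero)
    with B[OF ij] have B0: "[:0, 1:] * B i j - (\<Sum>k<n. [:lmult_mat sm b n x $$ (i, k):] * B k j) =
      (if i = j then f else 0)" by simp
    have "(C * BM) $$ (i, j) = (\<Sum>k = 0..<n. C $$ (i, k) * B k j)"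
      using ij C by (simp add: scalar_prod_def BM_def)
    also have "\<dots> = (\<Sum>k<n. (if i = k then [:0, 1:] * B k j else 0)
        - [:lmult_mat sm b n x $$ (i, k):] * B k j)"
      unfolding atLeast0LessThan
    proof (rule sum.cong[OF refl])
      fix k assume "k \<in> {..<n}"
      then have "C $$ (i, k) = (if i = k then [:0, 1:] else 0) - [:lmult_mat sm b n x $$ (i, k):]"
        using ij by (simp add: C_def char_poly_matrix_def)
      then show "C $$ (i, k) * B k j = (if i = k then [:0, 1:] * B k j else 0)
        - [:lmult_mat sm b n x $$ (i, k):] * B k j"
        by (simp only: left_diff_distrib) simp
    qed
    also have "\<dots> = [:0, 1:] * B i j - (\<Sum>k<n. [:lmult_mat sm b n x $$ (i, k):] * B k j)"
      using ij by (simp only: sum_subtractf sum.delta' finite_lessThan) simp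
    finally show "(C * BM) $$ (i, j) = (f \<cdot>\<^sub>m 1\<^sub>m n) $$ (i, j)" using ij B0 by simp
  qed (use C in \<open>auto simp: BM_def\<close>)
  then have "det C * det BM = f ^ n"
    using det_mult[OF C, of BM] by (simp add: BM_def)
  then show ?thesis unfolding char_poly_def C_def by (metis dvd_triv_left)
qed

lemma mem_powers_iff: "y \<in> powers x m \<longleftrightarrow> (\<exists>c. y = (\<Sum>i<m. sm (c i) (x ^ i)))"
proof
  assume "y \<in> powers x m"
  then show "\<exists>c. y = (\<Sum>i<m. sm (c i) (x ^ i))"
    unfolding powers_def
  proof (induction rule: V.span_induct_alt)
    case base
    show ?case by (rule exI[of _ "\<lambda>i. 0"]) simp
  next
    case (step a u w)
    then obtain c j where cj: "w = (\<Sum>i<m. sm (c i) (x ^ i))" "j < m" "u = x ^ j" by auto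
    have "(\<Sum>i<m. sm ((if i = j then a else 0) + c i) (x ^ i)) =
      (\<Sum>i<m. if i = j then sm a (x ^ i) else 0) + w"
      unfolding cj sum.distrib[symmetric] by (intro sum.cong) (auto simp: sm_add_left)
    then have "(\<Sum>i<m. sm ((if i = j then a else 0) + c i) (x ^ i)) = sm a u + w"
      using cj by simp
    then show ?case by metis
  qed
next
  assume "\<exists>c. y = (\<Sum>i<m. sm (c i) (x ^ i))"
  then obtain c where "y = (\<Sum>i<m. sm (c i) (x ^ i))" by blast
  moreover have "sm (c i) (x ^ i) \<in> powers x m" if "i < m" for i
    unfolding powers_def using that by (intro V.span_scale V.span_base) auto
  ultimately show "y \<in> powers x m" unfolding powers_def by (auto intro: V.span_sum)
qed

lemma ev_root_power_dependent:
  assumes "ev x g = 0" "g \<noteq> 0"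
  shows "x ^ degree g \<in> powers x (degree g)"
proof -
  define a where "a = lead_coeff g"
  have a: "a \<noteq> 0" using assms by (simp add: a_def)
  have "0 = (\<Sum>i<degree g. sm (coeff g i) (x ^ i)) + sm a (x ^ degree g)"
    using assms ev_altdef[of g "Suc (degree g)" x] by (simp add: a_def)
  then have "sm a (x ^ degree g) = - (\<Sum>i<degree g. sm (coeff g i) (x ^ i))"
    by (metis add.commute add_eq_0_iff)
  then have "sm (inverse a) (sm a (x ^ degree g)) = sm (- inverse a) (\<Sum>i<degree g. sm (coeff g i) (x ^ i))"
    by simp
  then have "x ^ degree g = (\<Sum>i<degree g. sm (- inverse a * coeff g i) (x ^ i))"
    using a by (simp add: V.scale_sum_right)
  then show ?thesis by (subst mem_powers_iff) (rule exI)
qed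

text \<open>The polynomial is the monic relation of least degree among the powers of x. As D has no
  zero divisors, one factor of any factorization vanishes at x and by minimality has full degree,
  whence irreducibility.\<close>

lemma ex_min_poly:
  "\<exists>f. lead_coeff f = 1 \<and> degree f = V.dim (generated x) \<and> irreducible f \<and> ev x f = 0"
proof -
  define m where "m = (LEAST m. x ^ m \<in> powers x m)"
  have m: "x ^ m \<in> powers x m"
    unfolding m_def using ex_power_dependent[of x] by (metis LeastI)
  have least: "x ^ j \<notin> powers x j" if "j < m" for j
    using that not_less_Least unfolding m_def by blast
  have dim: "V.dim (generated x) = m"
    using powers_dim[OF least] generated_eq_powers[OF m] by simp
  obtain c where c: "x ^ m = (\<Sum>i<m. sm (c i) (x ^ i))"
    using m mem_powers_iff by blast
  have m0: "m > 0"
  proof (rule ccontr)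
    assume "\<not> m > 0"
    with m show False by (simp add: powers_def)
  qed
  define r where "r = (\<Sum>i<m. monom (- c i) i)"
  have r: "degree r < m" unfolding r_def
    by (rule degree_sum_less) (use m0 in \<open>auto intro: le_less_trans[OF degree_monom_le]\<close>)
  define f where "f = monom 1 m + r"
  have deg: "degree f = m" unfolding f_def
    by (subst degree_add_eq_left) (auto simp: degree_monom_eq r)
  have lead: "lead_coeff f = 1" unfolding deg using r by (simp add: f_def coeff_eq_0)
  have ev: "ev x f = 0"
    by (simp add: f_def r_def ev_add ev_sum ev_monom c sum_negf sm_one)
  have "irreducible f"
  proof (rule irreducibleI)
    show "f \<noteq> 0" using lead by auto
    show "\<not> f dvd 1" using deg m0 by (auto simp: is_unit_poly_iff)
    fix g h assume gh: "f = g * h"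
    then have nz: "g \<noteq> 0" "h \<noteq> 0" using lead by auto
    have degs: "degree g + degree h = m" using degree_mult_eq[OF nz] deg gh by simp
    have "ev x g = 0 \<or> ev x h = 0" using ev by (simp add: gh ev_mult)
    then have "degree g \<ge> m \<or> degree h \<ge> m"
      using ev_root_power_dependent nz least by (metis not_le)
    then have "degree h = 0 \<or> degree g = 0" using degs by auto
    then show "g dvd 1 \<or> h dvd 1"
      using nz by (metis is_unit_iff_degree)
  qed
  with lead deg dim ev show ?thesis by auto
qed

text \<open>A divisor of a power of the irreducible f is a constant times a power of f, and the
  constant is 1 since both polynomials are monic. The exponent is later found by comparing
  degrees.\<close>

lemma char_poly_eq_min_poly_power:
  "\<exists>f k. lead_coeff f = 1 \<and> degree f = V.dim (generated x) \<and> char_poly (lmult_mat sm b n x) = f ^ k"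
proof -
  obtain f where f: "lead_coeff f = 1" "degree f = V.dim (generated x)" "irreducible f" "ev x f = 0"
    using ex_min_poly by blast
  let ?\<chi> = "char_poly (lmult_mat sm b n x)"
  have "prime_elem f" using f(3) by (rule field_poly_irreducible_imp_prime)
  then obtain u k where u: "is_unit u" "?\<chi> = u * f ^ k"
    using dvd_prime_elem_power char_poly_dvd_power[OF f(4)] by blast
  obtain c where c: "u = [:c:]" using u(1) unfolding is_unit_poly_iff by blast
  have "lead_coeff ?\<chi> = 1" using degree_monic_char_poly[OF lmult_carrier] by metis
  then have "c = 1" using f(1) by (simp only: u(2) c lead_coeff_mult lead_coeff_power) simp
  then have "?\<chi> = f ^ k" using u(2) c by simp
  then show ?thesis using f by blast
qed

end

section \<open>Centralizers in a central division algebra of prime degree\<close>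

lemma geometric_sum_mult: "(\<Sum>i<m. h ^ i) * (h - 1) = h ^ m - (1::'a::ring_1)"
  by (induction m) (auto simp: algebra_simps power_Suc2 simp del: power_Suc)

locale central_division_algebra_prime_degree = division_algebra sm b "l ^ 2"
  for sm :: "'k::field_char_0 \<Rightarrow> 'd::division_ring \<Rightarrow> 'd" and b :: "nat \<Rightarrow> 'd" and l :: nat +
  assumes prime_l: "prime l" and central: "is_central sm"
begin

definition scalar :: "'d \<Rightarrow> bool" where
  "scalar x \<longleftrightarrow> (\<exists>a. x = sm a 1)"

definition cent :: "'d \<Rightarrow> 'd set" where
  "cent x = {y. y * x = x * y}"

lemma scalar_commute: "scalar z \<Longrightarrow> z * x = x * z"
  by (auto simp: scalar_def sm_one_mult)

lemma scalarI: "(\<And>y. x * y = y * x) \<Longrightarrow> scalar x"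
  using central unfolding is_central_def center_def scalar_def by blast

lemma subdiv_cent: "subdiv (cent x)"
proof (rule subdiv_if_closed_mult)
  show "V.subspace (cent x)"
    by (rule V.subspaceI) (auto simp: cent_def algebra_simps sm_mult_left sm_mult_right)
  show "1 \<in> cent x" by (simp add: cent_def)
  show "y * z \<in> cent x" if "y \<in> cent x" "z \<in> cent x" for y z
    using that unfolding cent_def by (metis (mono_tags, lifting) mem_Collect_eq mult.assoc)
qed

lemma self_in_cent: "x \<in> cent x"
  by (simp add: cent_def)

lemma cent_sym: "x \<in> cent y \<longleftrightarrow> y \<in> cent x"
  by (auto simp: cent_def)

lemma subdiv_dim_cases:
  assumes "subdiv S"
  shows "V.dim S = 1 \<or> V.dim S = l \<or> V.dim S = l ^ 2"
proof -
  have "V.dim S dvd V.dim UNIV" by (rule dim_subdiv_dvd[OF assms]) auto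
  then have "V.dim S dvd l ^ 2" by (simp only: dim_UNIV)
  then obtain i where "i \<le> 2" "V.dim S = l ^ i" using divides_primepow_nat[OF prime_l] by blast
  then show ?thesis by (auto simp: le_Suc_eq numeral_2_eq_2)
qed

lemma l_gt_1: "l > 1"
  using prime_l by (rule prime_gt_1_nat)

lemma l_less_square: "l < l ^ 2"
  using l_gt_1 by (simp add: power2_eq_square)

lemma dim_cent:
  assumes "\<not> scalar x"
  shows "V.dim (cent x) = l"
proof -
  have "V.dim (cent x) \<noteq> 1"
    using dim_one_iff_scalar[OF subdiv_cent _ self_in_cent] assms by (auto simp: scalar_def)
  moreover have "V.dim (cent x) \<noteq> l ^ 2"
  proof
    assume "V.dim (cent x) = l ^ 2"
    then have "cent x = UNIV"
      using V.subspace_dim_equal[of "cent x" UNIV] subdiv_cent[of x] dim_UNIV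
      by (auto simp: subdiv_def)
    then have "y \<in> cent x" for y by simp
    then have "scalar x" by (intro scalarI) (simp add: cent_def)
    then show False using assms by simp
  qed
  ultimately show ?thesis using subdiv_dim_cases[OF subdiv_cent] by blast
qed

text \<open>The intersection of C(x) and C(y) is a division subalgebra whose dimension divides the
  prime l = dim C(x). It contains the noncentral x, so it is all of C(x), and z commutes with
  y.\<close>

lemma cent_commutative:
  assumes x: "\<not> scalar x" and y: "y \<in> cent x" and z: "z \<in> cent x"
  shows "y * z = z * y"
proof (cases "scalar y")
  case False
  let ?I = "cent x \<inter> cent y"
  have I: "subdiv ?I"
    using subdiv_cent[of x] subdiv_cent[of y] by (auto simp: subdiv_def V.subspace_inter)
  have "V.dim ?I dvd V.dim (cent x)"
    by (rule dim_subdiv_dvd[OF I]) (use subdiv_cent[of x] in \<open>auto simp: subdiv_def\<close>)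
  then have "V.dim ?I = 1 \<or> V.dim ?I = l" using dim_cent[OF x] prime_l by (metis prime_nat_iff)
  moreover have "x \<in> ?I" using y by (auto simp: cent_def)
  then have "V.dim ?I \<noteq> 1" using dim_one_iff_scalar[OF I] x by (auto simp: scalar_def)
  ultimately have "?I = cent x"
    using V.subspace_dim_equal[of ?I "cent x"] I subdiv_cent[of x] dim_cent[OF x] by (auto simp: subdiv_def)
  then have "z \<in> cent y" using z by blast
  then show ?thesis by (simp add: cent_def)
qed (rule scalar_commute)

lemma cent_eq:
  assumes x: "\<not> scalar x" and y: "y \<in> cent x" "\<not> scalar y"
  shows "cent y = cent x"
proof -
  have "cent x \<subseteq> cent y" if "\<not> scalar x" "y \<in> cent x" for x y
    using cent_commutative[OF that] by (auto simp: cent_def)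
  then show ?thesis using x y cent_sym by blast
qed

lemma dim_generated:
  "V.dim (generated x) = (if scalar x then 1 else l)"
proof (cases "scalar x")
  case True
  then obtain a where a: "x = sm a 1" by (auto simp: scalar_def)
  have "x ^ 1 = (\<Sum>i<1. sm a (x ^ i))" using a by simp
  then have "x ^ 1 \<in> powers x 1" unfolding mem_powers_iff by (intro exI[of _ "\<lambda>i. a"])
  then have "V.dim (generated x) \<le> 1" by (rule dim_generated_le)
  then show ?thesis using True subdiv_dim_cases[OF subdiv_generated[of x]] l_gt_1 l_less_square
    by auto
next
  case False
  have "V.dim (generated x) \<noteq> 1"
    using dim_one_iff_scalar[OF subdiv_generated _ x_mem_generated] False by (auto simp: scalar_def)
  moreover have "generated x \<subseteq> cent x"
    using generated_commute[OF _ x_mem_generated] by (auto simp: cent_def)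
  then have "V.dim (generated x) \<le> l" using V.dim_subset dim_cent[OF False] by metis
  then have "V.dim (generated x) \<noteq> l ^ 2" using l_gt_1 by (auto simp: power2_eq_square)
  ultimately show ?thesis using False subdiv_dim_cases[OF subdiv_generated[of x]] by auto
qed

text \<open>The characteristic polynomial is g^l with g monic of degree l: g is the minimal
  polynomial if x is not scalar, and the l-th power of the linear minimal polynomial otherwise.
  Evaluating at 0 gives det(-A), whose sign cancels against the l-th power of the sign in
  \<open>reduced_norm\<close>.\<close>

lemma reduced_norm_power: "reduced_norm sm b (l ^ 2) l x ^ l = nrm x"
proof -
  let ?A = "lmult_mat sm b (l ^ 2) x"
  let ?\<chi> = "char_poly ?A"
  obtain f k where f: "lead_coeff f = 1" "degree f = V.dim (generated x)" and \<chi>: "?\<chi> = f ^ k"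
    using char_poly_eq_min_poly_power by blast
  have "f \<noteq> 0" using f by auto
  then have "degree ?\<chi> = k * degree f" by (simp add: \<chi> degree_power_eq)
  moreover have "degree ?\<chi> = l ^ 2" using degree_monic_char_poly[OF lmult_carrier] by metis
  ultimately have deg: "k * degree f = l ^ 2" by simp
  have "\<exists>g. lead_coeff g = 1 \<and> degree g = l \<and> g ^ l = ?\<chi>"
  proof (cases "scalar x")
    case True
    then have "degree f = 1" using f dim_generated by auto
    then have "degree (f ^ l) = l" "k = l * l"
      using deg \<open>f \<noteq> 0\<close> by (simp_all add: degree_power_eq power2_eq_square)
    then have "(f ^ l) ^ l = ?\<chi>" using \<chi> power_mult[of f l l] by simp
    moreover have "lead_coeff (f ^ l) = 1" by (simp only: lead_coeff_power f(1) power_one)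
    ultimately show ?thesis by (intro exI[of _ "f ^ l"] conjI \<open>degree (f ^ l) = l\<close>)
  next
    case False
    then have "degree f = l" using f dim_generated by auto
    then have "k = l" using deg l_gt_1 by (auto simp: power2_eq_square)
    then have "f ^ l = ?\<chi>" using \<chi> by simp
    then show ?thesis by (intro exI[of _ f] conjI f(1) \<open>degree f = l\<close>)
  qed
  then obtain g where g: "lead_coeff g = 1" "degree g = l" "g ^ l = ?\<chi>" by blast
  have "reduced_charpoly sm b (l ^ 2) l x = g"
    unfolding reduced_charpoly_def
    by (rule the_equality) (use g monic_power_inject[of _ g l] l_gt_1 in auto)
  moreover have "poly ?\<chi> 0 = coeff g 0 ^ l"
    unfolding g(3)[symmetric] poly_0_coeff_0[symmetric] by simp
  ultimately have "reduced_norm sm b (l ^ 2) l x ^ l = (- 1) ^ (l * l) * poly ?\<chi> 0"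
    by (simp add: reduced_norm_def power_mult_distrib power_mult)
  also have "poly ?\<chi> 0 = det ((- 1) \<cdot>\<^sub>m ?A)"
    unfolding char_poly_def
    by (rule poly_det_cong[of _ "l ^ 2"]) (auto simp: char_poly_matrix_def)
  also have "\<dots> = (- 1) ^ (l * l) * nrm x" 
    by (simp only: det_smult lmult_dim nrm_def) (simp only: power2_eq_square)
  finally show ?thesis by (simp flip: power_mult_distrib mult.assoc)
qed

lemma ex_nonscalar: "\<exists>x. \<not> scalar x"
proof (rule ccontr)
  assume "\<not> ?thesis"
  then have "UNIV \<subseteq> V.span {1}" by (auto simp: scalar_def V.span_singleton)
  then have "V.dim UNIV \<le> card {1::'d}" by (rule V.dim_le_card) auto
  then have "l ^ 2 \<le> 1" by (simp only: dim_UNIV) simp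
  then show False using l_gt_1 by (metis one_less_power not_le zero_less_numeral)
qed

lemma power_neq_one:
  assumes h: "\<not> scalar h" and m: "0 < m" "m \<le> l"
  shows "h ^ m \<noteq> 1"
proof
  assume "h ^ m = 1"
  moreover have "h \<noteq> 1" using h sm_one[of 1] unfolding scalar_def by metis
  ultimately have "(\<Sum>i<m. h ^ i) = 0" using geometric_sum_mult[of h m] by simp
  \<comment> \<open>The relation 1 + h + ... + h^(m-1) = 0 has degree m - 1, one less than m, so
    even m = l contradicts the degree of h.\<close>
  moreover obtain j where j: "m = Suc j" using m by (cases m) auto
  ultimately have "h ^ j = - (\<Sum>i<j. h ^ i)" by (simp add: add_eq_0_iff)
  then have "h ^ j = (\<Sum>i<j. sm (- 1) (h ^ i))" by (simp add: sm_one sum_negf)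
  then have "h ^ j \<in> powers h j" unfolding mem_powers_iff by (intro exI[of _ "\<lambda>i. - 1"])
  then have "V.dim (generated h) \<le> j" by (rule dim_generated_le)
  then show False using h m j by (simp add: dim_generated)
qed

lemma ex_power_dependent_le_degree:
  assumes "\<not> scalar h"
  shows "\<exists>m\<le>l. h ^ m \<in> powers h m"
proof (rule ccontr)
  assume "\<not> ?thesis"
  then have "V.dim (powers h (Suc l)) = Suc l" by (intro powers_dim) auto
  moreover have "powers h (Suc l) \<subseteq> generated h"
    unfolding powers_def generated_def by (intro V.span_mono) auto
  then have "V.dim (powers h (Suc l)) \<le> l" using V.dim_subset dim_generated[of h] assms by metis
  ultimately show False by simp
qed

text \<open>Artin's independence of characters, applied to the relation of least degree among the powers
  of \<open>h\<close> with left coefficients in \<open>L\<close>.\<close>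
lemma power_commutes_if_normalizes:
  assumes L: "subdiv L" and comm: "\<And>y z. y \<in> L \<Longrightarrow> z \<in> L \<Longrightarrow> y * z = z * y"
    and conj: "\<And>y. y \<in> L \<Longrightarrow> h * y * inverse h \<in> L" and h: "\<not> scalar h"
  shows "\<exists>m. 0 < m \<and> m \<le> l \<and> (\<forall>y\<in>L. h ^ m * y = y * h ^ m)"
proof -
  have h0: "h \<noteq> 0" using h V.scale_zero_left unfolding scalar_def by metis
  have L_sub: "V.subspace L" and L1: "1 \<in> L" and L_mult: "\<And>x y. x \<in> L \<Longrightarrow> y \<in> L \<Longrightarrow> x * y \<in> L"
    and L_inv: "\<And>x. x \<in> L \<Longrightarrow> inverse x \<in> L"
    using L by (auto simp: subdiv_def)
  define P where "P m \<longleftrightarrow> (\<exists>c. (\<forall>i. c i \<in> L) \<and> h ^ m = (\<Sum>i<m. c i * h ^ i))" for m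
  obtain k where k: "k \<le> l" "h ^ k \<in> powers h k" using ex_power_dependent_le_degree[OF h] by blast
  then obtain c0 where "h ^ k = (\<Sum>i<k. sm (c0 i) (h ^ i))" using mem_powers_iff by blast
  then have "h ^ k = (\<Sum>i<k. sm (c0 i) 1 * h ^ i)" by (simp add: sm_one_mult)
  moreover have "\<forall>i. sm (c0 i) 1 \<in> L" using L_sub L1 V.subspace_scale by blast
  ultimately have "P k" unfolding P_def by (intro exI[of _ "\<lambda>i. sm (c0 i) 1"]) simp
  define m where "m = (LEAST m. P m)"
  have Pm: "P m" and ml: "m \<le> l" and least: "\<And>j. j < m \<Longrightarrow> \<not> P j"
    unfolding m_def using \<open>P k\<close> k(1) by (auto intro: LeastI Least_le order_trans dest: not_less_Least)
  obtain c where c: "\<And>i. c i \<in> L" "h ^ m = (\<Sum>i<m. c i * h ^ i)"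
    using Pm unfolding P_def by blast
  have m0: "m > 0" using c(2) by (cases m) auto
  \<comment> \<open>Minimality of m makes 1, h, ..., h^(m-1) left independent over L: dividing a
    relation by its last nonzero coefficient would give a smaller exponent with property
    \<open>P\<close>.\<close>
  have indep: "\<forall>i<j. d i = 0"
    if "j \<le> m" "\<And>i. d i \<in> L" "(\<Sum>i<j. d i * h ^ i) = 0" for j d
    using that
  proof (induction j)
    case (Suc j)
    have "d j = 0"
    proof (rule ccontr)
      assume dj: "d j \<noteq> 0"
      have "d j * h ^ j = - (\<Sum>i<j. d i * h ^ i)" using Suc.prems by (simp add: add_eq_0_iff)
      then have "inverse (d j) * (d j * h ^ j) = inverse (d j) * - (\<Sum>i<j. d i * h ^ i)" by simp
      then have "h ^ j = (\<Sum>i<j. (- inverse (d j) * d i) * h ^ i)"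
        using dj by (simp add: mult.assoc[symmetric] sum_distrib_left sum_negf)
      moreover have "- inverse (d j) * d i \<in> L" for i
        using Suc.prems by (intro L_mult V.subspace_neg L_sub L_inv)
      ultimately have "P j" unfolding P_def by (intro exI[of _ "\<lambda>i. - inverse (d j) * d i"]) simp
      then show False using least Suc.prems by simp
    qed
    moreover have "\<forall>i<j. d i = 0"
      by (rule Suc.IH) (use Suc.prems \<open>d j = 0\<close> in simp_all)
    ultimately show ?case by (simp add: less_Suc_eq)
  qed simp
  have conj_power: "h ^ i * y * inverse h ^ i \<in> L" if "y \<in> L" for i y
    using that
  proof (induction i arbitrary: y)
    case (Suc i)
    have "h ^ Suc i * y * inverse h ^ Suc i = h ^ i * (h * y * inverse h) * inverse h ^ i"
      by (simp only: power_Suc2[of h] power_Suc[of "inverse h"] mult.assoc)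
    then show ?case using Suc conj by simp
  qed simp
  have cancel: "inverse h ^ i * h ^ i = 1" for i
    using h0 by (simp add: power_inverse)
  \<comment> \<open>If the constant term vanished, a factor h could be cancelled on the right,
    leaving a shorter relation.\<close>
  have c0: "c 0 \<noteq> 0"
  proof
    assume "c 0 = 0"
    obtain j where j: "m = Suc j" using m0 by (cases m) auto
    have "h ^ j * h = (\<Sum>i<j. c (Suc i) * h ^ i) * h"
      using c(2) \<open>c 0 = 0\<close> unfolding j
      by (simp add: sum.lessThan_Suc_shift power_Suc2 sum_distrib_right mult.assoc del: power_Suc sum.lessThan_Suc)
    then have "h ^ j = (\<Sum>i<j. c (Suc i) * h ^ i)" using h0 by simp
    then have "P j" using c(1) unfolding P_def by (intro exI[of _ "\<lambda>i. c (Suc i)"]) simp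
    then show False using least j by simp
  qed
  have "h ^ m * y = y * h ^ m" if y: "y \<in> L" for y
  proof -
    \<comment> \<open>\<open>s i\<close> is y conjugated i times by h, so h^i y = s_i h^i.
      Multiplying the relation by y on the right and by s_m on the left and subtracting removes h^m,
      so c_i s_i = s_m c_i for all i < m. For i = 0 commutativity of L gives s_m = y, that is, h^m
      commutes with y.\<close>
    define s where "s i = h ^ i * y * inverse h ^ i" for i
    have s: "s i \<in> L" "s i * h ^ i = h ^ i * y" for i
      using conj_power[OF y] by (simp_all add: s_def mult.assoc cancel)
    have "(\<Sum>i<m. (c i * s i - s m * c i) * h ^ i) = (\<Sum>i<m. c i * h ^ i) * y - s m * (\<Sum>i<m. c i * h ^ i)"
      by (simp add: left_diff_distrib sum_subtractf sum_distrib_left sum_distrib_right mult.assoc s(2))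
    also have "\<dots> = 0" by (simp add: s(2) flip: c(2))
    finally have "\<forall>i<m. c i * s i - s m * c i = 0"
      using c(1) s(1) by (intro indep[of m "\<lambda>i. c i * s i - s m * c i"] V.subspace_diff[OF L_sub] L_mult) auto
    then have "c 0 * s 0 = s m * c 0" using m0 by auto
    also have "\<dots> = c 0 * s m" by (rule comm[OF s(1) c(1)])
    finally have "s 0 = s m" using c0 by simp
    then have "s m = y" by (simp add: s_def)
    with s(2)[of m] show ?thesis by simp
  qed
  then show ?thesis using m0 ml by blast
qed

lemma ex_noncommuting:
  "\<exists>x y :: 'd. x \<noteq> 0 \<and> y \<noteq> 0 \<and> x * y \<noteq> y * x"
proof -
  obtain x where x: "\<not> scalar x" using ex_nonscalar by blast
  then obtain y where xy: "x * y \<noteq> y * x" using scalarI by blast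
  then have "x \<noteq> 0" "y \<noteq> 0" by auto
  then show ?thesis using xy by (intro exI[of _ x] exI[of _ y] conjI)
qed

end

section \<open>The CSA property and non-commutativity of SL_1(D)\<close>

locale central_division_algebra_no_roots = central_division_algebra_prime_degree sm b l
  for sm :: "'k::field_char_0 \<Rightarrow> 'd::division_ring \<Rightarrow> 'd" and b :: "nat \<Rightarrow> 'd" and l :: nat +
  assumes root_of_unity: "\<And>a::'k. a ^ l = 1 \<Longrightarrow> a = 1"
begin

abbreviation G :: "'d set" where
  "G \<equiv> SL1 sm b (l ^ 2) l"

text \<open>The determinant sees only the l-th power of the reduced norm;
  \<open>root_of_unity\<close> recovers reduced norm 1 from it.\<close>

lemma SL1_iff: "x \<in> G \<longleftrightarrow> nrm x = 1"
proof
  assume "x \<in> G"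
  then have "reduced_norm sm b (l ^ 2) l x = 1" by (simp add: SL1_def)
  then show "nrm x = 1" using reduced_norm_power[of x] by simp
next
  assume "nrm x = 1"
  then have "reduced_norm sm b (l ^ 2) l x = 1"
    using reduced_norm_power[of x] by (simp add: root_of_unity)
  then show "x \<in> G" by (simp add: SL1_def)
qed

lemma scalar_SL1:
  assumes "scalar x" "nrm x = 1"
  shows "x = 1"
proof -
  obtain a where a: "x = sm a 1" using assms(1) by (auto simp: scalar_def)
  then have "a ^ (l ^ 2) = 1" using assms(2) nrm_scalar[of a] by simp
  then have "(a ^ l) ^ l = 1" by (simp add: power2_eq_square power_mult)
  then have "a = 1" using root_of_unity root_of_unity[of "a ^ l"] by simp
  then show ?thesis using a by (simp add: sm_one)
qed

text \<open>Both c and its conjugate are noncentral elements of C(x), so each has C(x) as its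
  centralizer. Conjugation by h carries the first centralizer to the second, hence h normalizes C(x)
  and some power h^m with m at most l commutes with C(x). A noncentral h^m would again have
  centralizer C(x), which would then contain h.\<close>

lemma malnormal_cent:
  assumes x: "\<not> scalar x" and h: "nrm h = 1" "h \<notin> cent x"
    and c: "c \<in> cent x" "\<not> scalar c" "h * c * inverse h \<in> cent x"
  shows False
proof -
  let ?c' = "h * c * inverse h"
  have h0: "h \<noteq> 0" using h by auto
  have h': "\<not> scalar h" using h(2) scalar_commute by (auto simp: cent_def)
  have "\<not> scalar ?c'"
  proof
    assume s: "scalar ?c'"
    have "inverse h * ?c' * h = c" using h0 by (simp add: mult.assoc) (simp flip: mult.assoc)
    moreover have "inverse h * ?c' * h = ?c'"
      using scalar_commute[OF s, of "inverse h"] h0 by (metis mult.assoc mult.right_neutral left_inverse)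
    ultimately show False using s c by simp
  qed
  then have eq': "cent ?c' = cent x" and eq: "cent c = cent x"
    using cent_eq[OF x] c by auto
  have conj: "h * y * inverse h \<in> cent x" if "y \<in> cent x" for y
  proof -
    have yc: "y * c = c * y" using cent_commutative[OF x that c(1)] .
    have "(h * y * inverse h) * ?c' = h * (y * c) * inverse h"
      using h0 by (simp add: mult.assoc) (simp flip: mult.assoc)
    also have "\<dots> = ?c' * (h * y * inverse h)"
      unfolding yc using h0 by (simp add: mult.assoc) (simp flip: mult.assoc)
    finally show ?thesis unfolding eq'[symmetric] by (simp add: cent_def)
  qed
  obtain m where m: "0 < m" "m \<le> l" "\<And>y. y \<in> cent x \<Longrightarrow> h ^ m * y = y * h ^ m"
    using power_commutes_if_normalizes[OF subdiv_cent cent_commutative[OF x] conj h'] by blast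
  have mem: "h ^ m \<in> cent x" using m(3)[OF self_in_cent] by (simp add: cent_def)
  have "scalar (h ^ m)"
  proof (rule ccontr)
    assume "\<not> scalar (h ^ m)"
    then have "cent (h ^ m) = cent x" using cent_eq[OF x mem] by blast
    moreover have "h \<in> cent (h ^ m)" by (simp add: cent_def power_commutes)
    ultimately show False using h by simp
  qed
  then have "h ^ m = 1" using h by (intro scalar_SL1) (auto simp: nrm_power)
  then show False using power_neq_one[OF h' m(1,2)] by simp
qed

lemma nonscalar_SL1: "x \<in> G \<Longrightarrow> x \<noteq> 1 \<Longrightarrow> \<not> scalar x"
  using scalar_SL1 SL1_iff by blast

lemma centralizer_SL1: "centralizer G x = G \<inter> cent x"
  by (auto simp: centralizer_def cent_def)

lemma CSA_SL1: "CSA_group G"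
  unfolding CSA_group_def CA_group_def
proof (intro conjI ballI impI)
  fix x assume x: "x \<in> G" "x \<noteq> 1"
  note ns = nonscalar_SL1[OF x]
  show "is_abelian_set (centralizer G x)"
    unfolding is_abelian_set_def centralizer_SL1 using cent_commutative[OF ns] by blast
  show "malnormal G (centralizer G x)"
    unfolding malnormal_def
  proof (intro ballI)
    fix h assume h: "h \<in> G - centralizer G x"
    then have h': "nrm h = 1" "h \<notin> cent x" by (auto simp: SL1_iff centralizer_SL1)
    then have h0: "h \<noteq> 0" by auto
    have one: "1 \<in> centralizer G x" by (auto simp: centralizer_def SL1_iff)
    have "h * c * inverse h = 1"
      if c: "c \<in> centralizer G x" "h * c * inverse h \<in> centralizer G x" for c
    proof -
      have "scalar c" using malnormal_cent[OF ns h'] c by (auto simp: centralizer_SL1)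
      then have "c = 1" using c scalar_SL1 by (auto simp: centralizer_SL1 SL1_iff)
      then show ?thesis using h0 by simp
    qed
    moreover have "1 = h * 1 * inverse h" using h0 by simp
    ultimately show "{h * c * inverse h |c. c \<in> centralizer G x} \<inter> centralizer G x = {1}"
      using one by blast
  qed
qed

lemma not_abelian_SL1: "\<not> is_abelian_set G"
proof
  assume ab: "is_abelian_set G"
  obtain x y :: 'd where xy: "x \<noteq> 0" "y \<noteq> 0" "x * y \<noteq> y * x"
    using ex_noncommuting by (elim exE conjE)
  define comm where "comm x y = x * y * inverse x * inverse y" for x y :: 'd
  have comm_G: "comm x y \<in> G" if "x \<noteq> 0" "y \<noteq> 0" for x y
    unfolding SL1_iff comm_def nrm_mult nrm_inverse using that by (simp add: field_simps)
  define c where "c = comm x y"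
  have c_y: "c * y * x = x * y" unfolding c_def comm_def using xy by (simp add: mult.assoc)
  have "c \<in> G" unfolding c_def using xy comm_G by blast
  moreover have "c \<noteq> 1" using c_y xy by auto
  ultimately have ns: "\<not> scalar c" by (rule nonscalar_SL1)
  then have c0: "c \<noteq> 0" using c_y xy by auto
  \<comment> \<open>The commutator of h and c lies in the group, so it commutes with c by
    assumption, and h c h^-1 is this commutator times c.\<close>
  have conj: "h * c * inverse h \<in> cent c" if "h \<noteq> 0" for h
  proof -
    have "comm h c \<in> cent c"
      using ab comm_G[OF that c0] \<open>c \<in> G\<close> unfolding is_abelian_set_def cent_def by blast
    then have "comm h c * c \<in> cent c" using subdiv_cent[of c] self_in_cent by (auto simp: subdiv_def)
    then show ?thesis using c0 by (simp add: comm_def mult.assoc)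
  qed
  obtain h where h: "h \<notin> cent c" using ns scalarI[of c] by (force simp: cent_def)
  have sub: "V.subspace (cent c)" "1 \<in> cent c" using subdiv_cent[of c] by (auto simp: subdiv_def)
  have h0: "h \<noteq> 0" using h sub V.subspace_0 by auto
  have h1: "1 + h \<noteq> 0"
  proof
    assume "1 + h = 0"
    then have "h = - 1" by (simp add: add_eq_0_iff)
    then show False using h sub V.subspace_neg by auto
  qed
  \<comment> \<open>The trick of Cartan, Brauer and Hua: subtracting c' h = h c from c'' (1 + h) =
    (1 + h) c gives (c'' - c') h = c - c''. If c'' and c' differ, this expresses h by elements of
    the division algebra C(c); if they agree, then c = c' commutes with h.\<close>
  define c' where "c' = h * c * inverse h"
  define c'' where "c'' = (1 + h) * c * inverse (1 + h)"
  have mem: "c' \<in> cent c" "c'' \<in> cent c" using conj h0 h1 by (auto simp: c'_def c''_def)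
  have e1: "c' * h = h * c" using h0 by (simp add: c'_def mult.assoc)
  have "c'' * (1 + h) = (1 + h) * c" using h1 by (simp add: c''_def mult.assoc)
  then have e2: "(c'' - c') * h = c - c''" using e1 by (simp add: algebra_simps)
  have "c'' = c'"
  proof (rule ccontr)
    assume "c'' \<noteq> c'"
    then have "h = inverse (c'' - c') * (c - c'')" by (simp add: mult.assoc[symmetric] flip: e2)
    moreover have "inverse (c'' - c') * (c - c'') \<in> cent c"
      using subdiv_cent[of c] mem self_in_cent[of c] V.subspace_diff by (auto simp: subdiv_def)
    ultimately show False using h by simp
  qed
  then have "c = c'" using e2 by simp
  then show False using e1 h by (simp add: cent_def)
qed

end

section \<open>The field of p-adic numbers\<close>

text \<open>Expanding \<open>(1 + x) ^ N\<close> into \<open>N + 1\<close> terms costs only a power of \<open>A\<close> that is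
  logarithmic in \<open>N\<close>, so taking \<open>N\<close>-th roots removes the constant.\<close>
lemma ultrametric_if_quasi_ultrametric:
  fixes f :: "'a::division_ring \<Rightarrow> real"
  assumes mult: "\<And>x y. f (x * y) = f x * f y" and nonneg: "\<And>x. f x \<ge> 0"
    and one: "f 1 = 1" and zero: "f 0 = 0"
    and quasi: "\<And>x y. f (x + y) \<le> A * max (f x) (f y)" and A: "A \<ge> 1"
    and of_nat: "\<And>k. f (of_nat k) \<le> 1"
  shows "f (x + y) \<le> max (f x) (f y)"
proof -
  have split: "(\<Sum>i<j + d. g i) = (\<Sum>i<j. g i) + (\<Sum>i<d. g (j + i))" for g :: "nat \<Rightarrow> 'a" and j d
    by (induction d) (simp_all add: add.assoc)
  \<comment> \<open>Dyadic splitting: each halving of the index range costs one factor A.\<close>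
  have sum: "f (\<Sum>i<k. g i) \<le> A ^ m" if "k \<le> 2 ^ m" "\<And>i. f (g i) \<le> 1" for k m :: nat and g
    using that
  proof (induction m arbitrary: k g)
    case 0
    then have "k = 0 \<or> k = 1" by auto
    then show ?case using 0 zero by auto
  next
    case (Suc m)
    define j where "j = min k (2 ^ m)"
    have "(\<Sum>i<k. g i) = (\<Sum>i<j. g i) + (\<Sum>i<k-j. g (j + i))"
      using split[of g j "k - j"] by (simp add: j_def)
    then have "f (\<Sum>i<k. g i) \<le> A * max (f (\<Sum>i<j. g i)) (f (\<Sum>i<k-j. g (j + i)))"
      using quasi by simp
    also have "f (\<Sum>i<j. g i) \<le> A ^ m" by (rule Suc.IH) (use Suc.prems in \<open>auto simp: j_def\<close>)
    moreover have "f (\<Sum>i<k-j. g (j + i)) \<le> A ^ m" by (rule Suc.IH) (use Suc.prems in \<open>auto simp: j_def\<close>)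
    ultimately show ?case using A
      by (smt (verit, best) mult_left_mono power_Suc)
  qed
  \<comment> \<open>The coefficients are the binomial ones, but the estimate uses only that they are
    natural numbers, on which f is at most 1.\<close>
  have expand: "\<exists>a::nat \<Rightarrow> nat. (1 + x) ^ N = (\<Sum>k<Suc N. of_nat (a k) * x ^ k)" for x :: 'a and N
  proof (induction N)
    case 0
    show ?case by (intro exI[of _ "\<lambda>k. 1"]) simp
  next
    case (Suc N)
    then obtain a :: "nat \<Rightarrow> nat" where a: "(1 + x) ^ N = (\<Sum>k<Suc N. of_nat (a k) * x ^ k)" by blast
    define a' where "a' k = (if k < Suc N then a k else 0) + (case k of 0 \<Rightarrow> 0 | Suc j \<Rightarrow> a j)" for k
    have "(\<Sum>k<Suc (Suc N). of_nat (a' k) * x ^ k)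
      = (\<Sum>k<Suc (Suc N). of_nat (if k < Suc N then a k else 0) * x ^ k)
        + (\<Sum>k<Suc (Suc N). of_nat (case k of 0 \<Rightarrow> 0 | Suc j \<Rightarrow> a j) * x ^ k)"
      unfolding a'_def of_nat_add distrib_right sum.distrib ..
    also have "(\<Sum>k<Suc (Suc N). of_nat (if k < Suc N then a k else 0) * x ^ k) = (1 + x) ^ N"
      unfolding a by (subst sum.lessThan_Suc) simp
    also have "(\<Sum>k<Suc (Suc N). of_nat (case k of 0 \<Rightarrow> 0 | Suc j \<Rightarrow> a j) * x ^ k)
      = (\<Sum>k<Suc N. of_nat (a k) * x ^ Suc k)"
      by (subst sum.lessThan_Suc_shift) simp
    also have "\<dots> = (1 + x) ^ N * x"
      unfolding a sum_distrib_right by (simp add: mult.assoc power_commutes)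
    finally have "(1 + x) ^ Suc N = (\<Sum>k<Suc (Suc N). of_nat (a' k) * x ^ k)"
      by (simp add: power_Suc2 distrib_left del: power_Suc)
    then show ?case by blast
  qed
  have power: "f (x ^ k) = f x ^ k" for x k by (induction k) (auto simp: one mult)
  have main: "f (1 + x) \<le> 1" if x: "f x \<le> 1" for x
  proof (rule ccontr)
    assume "\<not> f (1 + x) \<le> 1"
    then have t: "f (1 + x) > 1" by simp
    \<comment> \<open>Take N = r m with m so large that the N + 1 terms number at most 2^m. The
      expansion then bounds the m-th power of f(1 + x)^r by A^m, against the choice of r.\<close>
    then obtain r where r: "A < f (1 + x) ^ r" using real_arch_pow by blast
    have "eventually (\<lambda>m::nat. real r * real m + 1 \<le> 2 ^ m \<and> m > 0) at_top"
      by (intro eventually_conj eventually_gt_at_top) real_asymp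
    then obtain m :: nat where m: "real r * real m + 1 \<le> 2 ^ m" "m > 0"
      by (metis (mono_tags, lifting) eventually_at_top_linorder order_refl)
    from m(1) have rm: "Suc (r * m) \<le> 2 ^ m"
      by (metis add.commute of_nat_Suc of_nat_le_iff of_nat_mult of_nat_numeral of_nat_power)
    obtain a :: "nat \<Rightarrow> nat" where "(1 + x) ^ (r * m) = (\<Sum>k<Suc (r * m). of_nat (a k) * x ^ k)"
      using expand by blast
    moreover have "f (of_nat (a k) * x ^ k) \<le> 1" for k
      using of_nat nonneg x by (simp add: mult power mult_le_one power_le_one)
    ultimately have "f ((1 + x) ^ (r * m)) \<le> A ^ m" using sum[OF rm] by (simp del: sum.lessThan_Suc)
    then have "(f (1 + x) ^ r) ^ m \<le> A ^ m" by (simp add: power power_mult)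
    moreover have "A ^ m < (f (1 + x) ^ r) ^ m" using r A m(2) by (intro power_strict_mono) auto
    ultimately show False by simp
  qed
  have wlog: "f (x + y) \<le> f y" if "f x \<le> f y" "y \<noteq> 0" for x y
  proof -
    have 1: "f y * f (inverse y) = 1" using that one by (simp flip: mult)
    then have y: "f y > 0" by (metis nonneg less_eq_real_def mult_zero_left zero_neq_one)
    have "f x * f (inverse y) \<le> f y * f (inverse y)" using that nonneg by (intro mult_right_mono)
    then have "f (x * inverse y) \<le> 1" using 1 by (simp add: mult)
    then have "f (1 + x * inverse y) * f y \<le> 1 * f y" using main y by (intro mult_right_mono) auto
    moreover have "(1 + x * inverse y) * y = x + y" using that by (simp add: distrib_right mult.assoc)
    ultimately show ?thesis by (simp flip: mult)
  qed
  show ?thesis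
  proof (cases "f x \<le> f y")
    case True
    show ?thesis
    proof (cases "y = 0")
      case False then show ?thesis using wlog True by fastforce
    qed auto
  next
    case False
    then show ?thesis
      using wlog[of y x] zero nonneg by (cases "x = 0") (auto simp: add.commute max_def)
  qed
qed

locale Qp =
  fixes p :: nat and v :: "'k::field_char_0 \<Rightarrow> real"
  assumes p: "prime p" and Qp: "is_Qp p v"
begin

lemma p_gt_1: "p > 1"
  using p by (rule prime_gt_1_nat)

lemma abs_value: "is_abs_value v"
  using Qp by (simp add: is_Qp_def)

lemma v_nonneg [simp]: "v x \<ge> 0"
  and v_eq_0_iff [simp]: "v x = 0 \<longleftrightarrow> x = 0"
  and v_mult: "v (x * y) = v x * v y"
  and v_triangle: "v (x + y) \<le> v x + v y"
  using abs_value by (auto simp: is_abs_value_def)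

lemma v_rat: "v (of_rat q) = padic_abs p q"
  using Qp by (simp add: is_Qp_def)

lemma v_dense: "e > 0 \<Longrightarrow> \<exists>q. v (x - of_rat q) < e"
  using Qp by (simp add: is_Qp_def)

lemma v_complete:
  fixes s :: "nat \<Rightarrow> 'k"
  assumes "\<And>e. e > 0 \<Longrightarrow> \<exists>N. \<forall>m\<ge>N. \<forall>n\<ge>N. v (s m - s n) < e"
  shows "\<exists>L. \<forall>e>0. \<exists>N. \<forall>n\<ge>N. v (s n - L) < e"
  by (rule Qp[unfolded is_Qp_def, THEN conjunct2, THEN conjunct2, THEN conjunct2, THEN spec[of _ s], THEN mp])
    (use assms in blast)

lemma v_zero [simp]: "v 0 = 0"
  by simp

lemma v_pos_iff [simp]: "v x > 0 \<longleftrightarrow> x \<noteq> 0"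
  using v_nonneg[of x] v_eq_0_iff[of x] by linarith

lemma v_one [simp]: "v 1 = 1"
  using v_mult[of 1 1] by simp

lemma v_power: "v (x ^ k) = v x ^ k"
  by (induction k) (auto simp: v_mult)

lemma v_minus [simp]: "v (- x) = v x"
proof -
  have "v (-1) ^ 2 = 1" by (simp flip: v_power)
  then have "v (-1) = 1" using v_nonneg[of "-1"] by (simp add: power2_eq_1_iff)
  then show ?thesis using v_mult[of "-1" x] by simp
qed

lemma v_minus_commute: "v (x - y) = v (y - x)"
  by (metis minus_diff_eq v_minus)

lemma v_inverse: "v (inverse x) = inverse (v x)"
proof (cases "x = 0")
  case False
  then have "v x * v (inverse x) = 1" by (simp flip: v_mult)
  then show ?thesis by (rule inverse_unique[symmetric])
qed simp

lemma v_divide: "v (x / y) = v x / v y"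
  by (simp add: divide_inverse v_mult v_inverse)

lemma v_of_int: "a \<noteq> 0 \<Longrightarrow> v (of_int a) = real p powr - real (multiplicity (int p) a)"
  using v_rat[of "of_int a"] by (simp add: padic_abs_def quotient_of_int)

lemma v_of_int_le_1: "v (of_int a) \<le> 1"
  using p_gt_1 powr_mono[of "- real (multiplicity (int p) a)" 0 "real p"]
  by (cases "a = 0") (simp_all add: v_of_int)

lemma v_of_nat_le_1: "v (of_nat a) \<le> 1"
  using v_of_int_le_1[of "int a"] by simp

lemma v_p: "v (of_nat p) = 1 / p"
proof -
  have "multiplicity (int p) (int p) = 1"
    using p by (intro multiplicity_self) auto
  then show ?thesis using v_of_int[of "int p"] p_gt_1 by (simp add: powr_minus_divide)
qed

lemma v_of_int_eq_1: "\<not> int p dvd a \<Longrightarrow> v (of_int a) = 1"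
  using v_of_int[of a] p_gt_1 by (cases "a = 0") (auto simp: not_dvd_imp_multiplicity_0)

lemma v_of_int_lt_1: "int p dvd a \<Longrightarrow> v (of_int a) < 1"
proof -
  assume "int p dvd a"
  then obtain c where c: "a = int p * c" by auto
  have "v (of_int a) = 1 / p * v (of_int c)" by (simp add: c v_mult v_p)
  also have "\<dots> \<le> 1 / p" using v_of_int_le_1 by (simp add: divide_right_mono)
  also have "\<dots> < 1" using p_gt_1 by simp
  finally show ?thesis .
qed

lemma v_of_nat_eq_1: "\<not> p dvd a \<Longrightarrow> v (of_nat a) = 1"
  using v_of_int_eq_1[of "int a"] by simp

text \<open>\<open>is_Qp\<close> provides the triangle inequality, which is the quasi-ultrametric
  inequality with constant 2; natural numbers have absolute value at most 1.\<close>

lemma v_ultra: "v (x + y) \<le> max (v x) (v y)"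
proof (rule ultrametric_if_quasi_ultrametric[of v 2])
  show "v (x + y) \<le> 2 * max (v x) (v y)" for x y using v_triangle[of x y] by linarith
qed (auto simp: v_mult v_of_nat_le_1)

lemma v_ultra_less: "v x < e \<Longrightarrow> v y < e \<Longrightarrow> v (x + y) < e"
  using v_ultra[of x y] by linarith

lemma v_ultra_diff_less: "v x < e \<Longrightarrow> v y < e \<Longrightarrow> v (x - y) < e"
  using v_ultra[of x "- y"] by simp

lemma v_ultra_le: "v x \<le> e \<Longrightarrow> v y \<le> e \<Longrightarrow> v (x + y) \<le> e"
  using v_ultra[of x y] by linarith

lemma v_ultra_diff_le: "v x \<le> e \<Longrightarrow> v y \<le> e \<Longrightarrow> v (x - y) \<le> e"
  using v_ultra[of x "- y"] by simp

lemma v_sum_less: "e > 0 \<Longrightarrow> (\<And>i. i \<in> A \<Longrightarrow> v (f i) < e) \<Longrightarrow> v (\<Sum>i\<in>A. f i) < e"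
  by (induction A rule: infinite_finite_induct) (auto intro: v_ultra_less)

lemma v_sum_le: "e \<ge> 0 \<Longrightarrow> (\<And>i. i \<in> A \<Longrightarrow> v (f i) \<le> e) \<Longrightarrow> v (\<Sum>i\<in>A. f i) \<le> e"
  by (induction A rule: infinite_finite_induct) (auto intro: v_ultra_le)

lemma v_eq_if_close:
  assumes "v (x - y) < v x"
  shows "v y = v x"
proof (rule antisym)
  show "v y \<le> v x" using v_ultra_diff_le[of x "v x" "x - y"] assms by simp
  show "v x \<le> v y" using v_ultra[of "x - y" y] assms by auto
qed

text \<open>A rational number closer to x than the size of x has the same absolute value, so the
  completion acquires no new values.\<close>

lemma ex_value: "x \<noteq> 0 \<Longrightarrow> \<exists>k::int. v x = real p powr k"
proof -
  assume x: "x \<noteq> 0"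
  then obtain q where "v (x - of_rat q) < v x" using v_dense[of "v x" x] by auto
  then have vq: "v (of_rat q) = v x" by (rule v_eq_if_close)
  then have "q \<noteq> 0" using x by auto
  obtain a b where "quotient_of q = (a, b)" by (cases "quotient_of q")
  then have "v x = real p powr (int (multiplicity (int p) b) - int (multiplicity (int p) a))"
    using vq \<open>q \<noteq> 0\<close> by (simp add: v_rat padic_abs_def)
  then show ?thesis by blast
qed

lemma v_le_if_lt_1:
  assumes "v x < 1" shows "v x \<le> 1 / p"
proof (cases "x = 0")
  case False
  then obtain k :: int where k: "v x = real p powr k" using ex_value by blast
  have "k < 0"
  proof (rule ccontr)
    assume "\<not> k < 0"
    then have "real p powr k \<ge> 1" using p_gt_1 by (intro ge_one_powr_ge_zero) auto
    then show False using k assms by simp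
  qed
  then have "real p powr k \<le> real p powr (-1)" using p_gt_1 by (intro powr_mono) auto
  then show ?thesis using k p_gt_1 by (simp add: powr_minus_divide)
qed simp

text \<open>The residue field is the prime field. A rational a/b close to x has b prime to p, as
  otherwise its absolute value would exceed 1; replacing 1/b by an inverse c of b modulo p gives the
  integer a c.\<close>

lemma ex_int_approx:
  assumes x: "v x \<le> 1"
  shows "\<exists>a::int. v (x - of_int a) < 1"
proof -
  obtain q where q: "v (x - of_rat q) < 1" using v_dense[of 1 x] by auto
  have vq: "v (of_rat q) \<le> 1" using v_ultra_diff_le[OF x, of "x - of_rat q"] q by simp
  obtain a b where ab: "quotient_of q = (a, b)" by (cases "quotient_of q")
  have b: "b > 0" "coprime a b" "q = of_int a / of_int b"
    using quotient_of_denom_pos[OF ab] quotient_of_coprime[OF ab] quotient_of_div[OF ab] by auto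
  have eq: "(of_rat q :: 'k) = of_int a / of_int b" by (simp add: b(3) of_rat_divide)
  have pb: "\<not> int p dvd b"
  proof
    assume pb: "int p dvd b"
    have "prime (int p)" using p by simp
    then have "\<not> int p dvd a" using b(2) pb by (metis coprime_common_divisor not_prime_unit)
    then have "v (of_rat q) = 1 / v (of_int b)" by (simp add: eq v_divide v_of_int_eq_1)
    moreover have "v (of_int b) < 1" "v (of_int b) > 0" using v_of_int_lt_1[OF pb] b by auto
    ultimately show False using vq by simp
  qed
  then have "coprime (int p) b" using p by (simp add: prime_imp_coprime)
  then obtain c where c: "[b * c = 1] (mod int p)"
    using cong_solve_coprime_int[of b "int p"] by (auto simp: coprime_commute)
  have bc: "int p dvd 1 - b * c" using c by (metis cong_iff_dvd_diff cong_sym)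
  have "of_int a / of_int b - of_int (a * c) = of_int a * of_int (1 - b * c) / (of_int b :: 'k)"
    using b(1) by (simp add: field_simps)
  then have "v (of_rat q - of_int (a * c)) = v (of_int a) * v (of_int (1 - b * c))"
    by (simp only: eq v_divide v_mult v_of_int_eq_1[OF pb] div_by_1)
  also have "\<dots> \<le> v (of_int (1 - b * c))"
    using v_of_int_le_1[of a] by (intro mult_left_le_one_le) auto
  also have "\<dots> < 1" by (rule v_of_int_lt_1[OF bc])
  finally have "v ((x - of_rat q) + (of_rat q - of_int (a * c))) < 1"
    using q by (intro v_ultra_less)
  then show ?thesis by (intro exI[of _ "a * c"]) simp
qed

section \<open>Compactness of the p-adic integers\<close>

lemma ex_nat_approx:
  assumes "v x \<le> 1"
  shows "\<exists>a<p ^ k. v (x - of_nat a) \<le> (1 / p) ^ k"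
  using assms
proof (induction k arbitrary: x)
  case (Suc k)
  obtain a :: int where a: "v (x - of_int a) < 1" using ex_int_approx[OF Suc.prems] by blast
  define a0 where "a0 = nat (a mod int p)"
  have a0: "a0 < p" "int a0 = a mod int p" using p_gt_1 by (simp_all add: a0_def nat_less_iff)
  have "of_int a - of_nat a0 = (of_int (a - a mod int p) :: 'k)" using a0(2) by (metis of_int_diff of_int_of_nat_eq)
  then have "v (of_int a - of_nat a0) < 1" using v_of_int_lt_1[of "a - a mod int p"] by simp
  then have "v ((x - of_int a) + (of_int a - of_nat a0)) < 1" using a by (intro v_ultra_less)
  then have le: "v (x - of_nat a0) \<le> 1 / p" by (intro v_le_if_lt_1) simp
  \<comment> \<open>Split off the lowest digit, x = a0 + p y, and read the remaining k digits from
    y.\<close>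
  define y where "y = (x - of_nat a0) / of_nat p"
  have "v y \<le> 1" using le p_gt_1 by (simp add: y_def v_divide v_p field_simps)
  then obtain a1 where a1: "a1 < p ^ k" "v (y - of_nat a1) \<le> (1 / p) ^ k" using Suc.IH by blast
  have "of_nat p * y = x - of_nat a0" using p_gt_1 by (simp add: y_def)
  then have "x - of_nat (a0 + p * a1) = of_nat p * (y - of_nat a1)" by (simp add: right_diff_distrib)
  then have "v (x - of_nat (a0 + p * a1)) = 1 / p * v (y - of_nat a1)" by (simp only: v_mult v_p)
  also have "\<dots> \<le> (1 / p) ^ Suc k" using a1(2) p_gt_1 by (simp add: divide_right_mono)
  finally have "v (x - of_nat (a0 + p * a1)) \<le> (1 / p) ^ Suc k" .
  moreover have "a0 + p * a1 < p ^ Suc k"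
  proof -
    have "a0 + p * a1 < p * Suc a1" using a0 by simp
    also have "\<dots> \<le> p * p ^ k" using a1(1) by (intro mult_le_mono2) simp
    finally show ?thesis by simp
  qed
  ultimately show ?case by blast
qed auto

text \<open>The unit ball is complete, and totally bounded because the natural numbers below p^k
  form a finite net of mesh p^-k. The type of K carries no topology of its own, so the metric is set
  up on the spot and the limit is expressed by a real sequence.\<close>

lemma seq_compact:
  assumes s: "\<And>i. v (s i) \<le> 1"
  shows "\<exists>r L. strict_mono (r :: nat \<Rightarrow> nat) \<and> (\<lambda>i. v (s (r i) - L)) \<longlonglongrightarrow> 0"
proof -
  define M where "M = {x. v x \<le> 1}"
  define d where "d x y = v (x - y)" for x y
  interpret Metric_space M d
  proof
    show "d x z \<le> d x y + d y z" for x y z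
      using v_triangle[of "x - y" "y - z"] by (simp add: d_def)
  qed (auto simp: d_def v_minus_commute)
  have "mcomplete"
    unfolding mcomplete_def
  proof (intro allI impI)
    fix \<sigma> assume \<sigma>: "MCauchy \<sigma>"
    then have mem: "\<sigma> i \<in> M" for i by (auto simp: MCauchy_def)
    have "\<exists>L. \<forall>e>0. \<exists>N. \<forall>n\<ge>N. v (\<sigma> n - L) < e"
    proof (rule v_complete)
      fix e :: real assume "e > 0"
      then obtain N where "\<forall>n n'. N \<le> n \<longrightarrow> N \<le> n' \<longrightarrow> v (\<sigma> n - \<sigma> n') < e"
        using \<sigma> unfolding MCauchy_def d_def by blast
      then show "\<exists>N. \<forall>m\<ge>N. \<forall>n\<ge>N. v (\<sigma> m - \<sigma> n) < e" by auto
    qed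
    then obtain L where L: "\<And>e. e > 0 \<Longrightarrow> \<exists>N. \<forall>n\<ge>N. v (\<sigma> n - L) < e" by blast
    obtain N where "v (\<sigma> N - L) < 1" using L[of 1] by auto
    then have "L \<in> M" using v_ultra_diff_le[of "\<sigma> N" 1 "\<sigma> N - L"] mem[of N] by (auto simp: M_def)
    then show "\<exists>x. limitin mtopology \<sigma> x sequentially"
      using L mem by (intro exI[of _ L]) (auto simp: limitin_metric eventually_sequentially d_def)
  qed
  moreover have "mtotally_bounded M"
    unfolding mtotally_bounded_def
  proof (intro allI impI)
    fix e :: real assume e: "e > 0"
    then obtain k where k: "(1 / p) ^ k < e"
      using real_arch_pow_inv[of e "1 / p"] p_gt_1 by auto
    show "\<exists>K. finite K \<and> K \<subseteq> M \<and> M \<subseteq> (\<Union>x\<in>K. mball x e)"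
    proof (intro exI[of _ "of_nat ` {..<p ^ k}"] conjI)
      show "M \<subseteq> (\<Union>x\<in>of_nat ` {..<p ^ k}. mball x e)"
      proof
        fix x assume "x \<in> M"
        then obtain a where a: "a < p ^ k" "v (x - of_nat a) \<le> (1 / p) ^ k"
          using ex_nat_approx by (auto simp: M_def)
        moreover have "of_nat a \<in> M" using v_of_nat_le_1 by (simp add: M_def)
        ultimately have "x \<in> mball (of_nat a) e"
          using \<open>x \<in> M\<close> k v_minus_commute[of x "of_nat a"] by (simp add: d_def)
        then show "x \<in> (\<Union>x\<in>of_nat ` {..<p ^ k}. mball x e)" using a by auto
      qed
    qed (auto simp: M_def v_of_nat_le_1)
  qed
  moreover have range_s: "range s \<subseteq> M" using s by (auto simp: M_def)
  ultimately have "compact_space mtopology" using compact_space_eq_mcomplete_mtotally_bounded by simp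
  then obtain L r where r: "L \<in> M" "strict_mono r" "limitin mtopology (s \<circ> r) L sequentially"
    unfolding compact_space_sequentially using range_s by blast
  have "(\<lambda>i. v (s (r i) - L)) \<longlonglongrightarrow> 0"
  proof (rule LIMSEQ_I)
    fix e :: real assume "e > 0"
    then have "\<exists>N. \<forall>i\<ge>N. s (r i) \<in> M \<and> v (s (r i) - L) < e"
      using r(3) by (simp add: limitin_metric eventually_sequentially d_def)
    then show "\<exists>N. \<forall>i\<ge>N. norm (v (s (r i) - L) - 0) < e" by auto
  qed
  with r(2) show ?thesis by blast
qed

lemma seq_compact_vector:
  fixes n :: nat and s :: "nat \<Rightarrow> nat \<Rightarrow> 'k"
  assumes s: "\<forall>i. \<forall>j<n. v (s i j) \<le> 1"
  shows "\<exists>r L. strict_mono (r :: nat \<Rightarrow> nat) \<and> (\<forall>j<n. (\<lambda>i. v (s (r i) j - L j)) \<longlonglongrightarrow> 0)"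
  using s
proof (induction n)
  case 0
  show ?case by (intro exI[of _ "\<lambda>i. i"]) (auto simp: strict_mono_def)
next
  case (Suc n)
  then obtain r L where r: "strict_mono (r :: nat \<Rightarrow> nat)" "\<And>j. j < n \<Longrightarrow> (\<lambda>i. v (s (r i) j - L j)) \<longlonglongrightarrow> 0"
    by (metis less_Suc_eq)
  obtain r' L' where r': "strict_mono (r' :: nat \<Rightarrow> nat)" "(\<lambda>i. v (s (r (r' i)) n - L')) \<longlonglongrightarrow> 0"
    using seq_compact[of "\<lambda>i. s (r i) n"] Suc.prems by auto
  have "(\<lambda>i. v (s ((r \<circ> r') i) j - (L(n := L')) j)) \<longlonglongrightarrow> 0" if "j < Suc n" for j
    using LIMSEQ_subseq_LIMSEQ[OF r(2) r'(1), of j] r'(2) that by (auto simp: o_def less_Suc_eq)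
  moreover have "strict_mono (r \<circ> r')" using r(1) r'(1) by (rule strict_mono_o)
  ultimately show ?case by blast
qed

section \<open>Roots of unity in Q_p\<close>

lemma power_close_to_one:
  assumes "v (x - 1) < 1"
  shows "v (x ^ i - 1) < 1"
proof (induction i)
  case (Suc i)
  have "v x = 1" using v_eq_if_close[of 1 x] assms v_minus_commute[of x 1] by simp
  then have "v ((x ^ i - 1) * x) < 1" using Suc by (simp add: v_mult)
  then have "v ((x ^ i - 1) * x + (x - 1)) < 1" using assms by (rule v_ultra_less)
  then show ?case by (simp add: algebra_simps)
qed simp

text \<open>If x is not 1, then 1 + x + ... + x^(m-1) = 0. All m terms are congruent to 1, so m
  would have absolute value below 1.\<close>

lemma root_of_unity_prime_to_p:
  assumes x: "v (x - 1) < 1" "x ^ m = 1" and m: "\<not> p dvd m"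
  shows "x = 1"
proof (rule ccontr)
  assume "x \<noteq> 1"
  then have "(\<Sum>i<m. x ^ i) = 0" using x(2) power_diff_1_eq[of x m] by simp
  then have "of_nat m = - (\<Sum>i<m. x ^ i - 1)" by (simp add: sum_subtractf)
  moreover have "v (\<Sum>i<m. x ^ i - 1) < 1" by (rule v_sum_less) (auto intro: power_close_to_one x)
  ultimately show False using v_of_nat_eq_1[OF m] by simp
qed

text \<open>For p-th roots of unity the congruence of the powers to 1 is too weak, since p itself is
  small; this supplies the linear term with a quadratic error.\<close>

lemma power_second_order:
  assumes "v y \<le> 1"
  shows "v ((1 + y) ^ i - 1 - of_nat i * y) \<le> v y ^ 2"
proof (induction i)
  case (Suc i)
  have "(1 + y) ^ Suc i - 1 - of_nat (Suc i) * y
    = ((1 + y) ^ i - 1 - of_nat i * y) * (1 + y) + of_nat i * (y * y)"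
    by (simp add: algebra_simps)
  moreover have "v (1 + y) \<le> 1" using assms by (intro v_ultra_le) auto
  then have "v (((1 + y) ^ i - 1 - of_nat i * y) * (1 + y)) \<le> v y ^ 2 * 1"
    unfolding v_mult by (intro mult_mono Suc) auto
  moreover have "v (of_nat i * (y * y)) \<le> 1 * (v y ^ 2)"
    unfolding v_mult power2_eq_square by (intro mult_mono v_of_nat_le_1) auto
  ultimately show ?case by (metis v_ultra_le mult_1 mult.right_neutral)
qed simp

text \<open>Put y = x - 1. For odd p the sum 0 + ... + (p-1) is divisible by p, so in 1 + x + ... +
  x^(p-1) = 0 the linear term and the error are both at most p^-2, while the constant term p has
  absolute value 1/p. For p = 2 the element -1 shows where oddness matters.\<close>

lemma p_th_root_of_unity:
  assumes x: "v (x - 1) < 1" "x ^ p = 1" and p_odd: "odd p"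
  shows "x = 1"
proof (rule ccontr)
  assume "x \<noteq> 1"
  define y where "y = x - 1"
  have y: "v y \<le> 1 / p" using v_le_if_lt_1 x(1) by (simp add: y_def)
  have p1: "1 / real p \<le> 1" using p_gt_1 by simp
  obtain c where c: "p - 1 = 2 * c" using p_odd p_gt_1 by (metis odd_two_times_div_two_nat)
  have "2 * (\<Sum>i<Suc q. i) = Suc q * q" for q :: nat
    by (induction q) auto
  from this[of "p - 1"] have "2 * (\<Sum>i<p. i) = p * (p - 1)" using p_gt_1 by simp
  then have sum: "(\<Sum>i<p. i) = p * c" using c by simp
  have "(\<Sum>i<p. x ^ i) = 0" using x(2) power_diff_1_eq[of x p] \<open>x \<noteq> 1\<close> by simp
  moreover have "(\<Sum>i<p. x ^ i) = of_nat p + of_nat (\<Sum>i<p. i) * y + (\<Sum>i<p. (1 + y) ^ i - 1 - of_nat i * y)"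
    by (simp add: sum_subtractf sum_distrib_right y_def)
  ultimately have "of_nat p = - (of_nat p * (of_nat c * y) + (\<Sum>i<p. (1 + y) ^ i - 1 - of_nat i * y))"
    unfolding sum by (simp add: add_eq_0_iff mult.assoc)
  then have "v (of_nat p) = v (of_nat p * (of_nat c * y) + (\<Sum>i<p. (1 + y) ^ i - 1 - of_nat i * y))"
    by (metis v_minus)
  also have "\<dots> \<le> (1 / p) ^ 2"
  proof (rule v_ultra_le)
    have "v (of_nat p * (of_nat c * y)) \<le> 1 / p * (1 * (1 / p))"
      unfolding v_mult v_p using y v_of_nat_le_1 by (intro mult_mono) auto
    then show "v (of_nat p * (of_nat c * y)) \<le> (1 / p) ^ 2" by (simp add: power2_eq_square)
    have "v y ^ 2 \<le> (1 / p) ^ 2" using y by (intro power_mono) auto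
    then show "v (\<Sum>i<p. (1 + y) ^ i - 1 - of_nat i * y) \<le> (1 / p) ^ 2"
      using order_trans[OF y p1] by (intro v_sum_le order_trans[OF power_second_order]) auto
  qed
  finally show False using p_gt_1 by (simp add: v_p power2_eq_square field_simps)
qed

text \<open>Fermat's little theorem for an integer a congruent to x; writing x = z a with z close to
  1 transfers it to x.\<close>

lemma power_p_minus_1_close_to_one:
  assumes x: "v x = 1"
  shows "v (x ^ (p - 1) - 1) < 1"
proof -
  obtain a :: int where a: "v (x - of_int a) < 1" using ex_int_approx[of x] x by auto
  have va: "v (of_int a) = 1" using v_eq_if_close[of x "of_int a"] a x by simp
  have pa: "\<not> int p dvd a" using v_of_int_lt_1 va by force
  have "[a ^ (p - 1) = 1] (mod int p)"
  proof -
    define c where "c = nat (a mod int p)"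
    have c: "int c = a mod int p" using p_gt_1 by (simp add: c_def)
    have "\<not> p dvd c" using pa c by (metis dvd_mod_iff dvd_refl int_dvd_int_iff)
    then have "[c ^ (p - 1) = 1] (mod p)" using p by (intro fermat_theorem)
    then have "[int c ^ (p - 1) = 1] (mod int p)" by (metis cong_int_iff of_nat_1 of_nat_power)
    moreover have "[int c = a] (mod int p)" by (simp add: c)
    ultimately show ?thesis by (metis cong_pow cong_sym cong_trans)
  qed
  then have "v (of_int (a ^ (p - 1) - 1)) < 1"
    by (intro v_of_int_lt_1) (simp add: cong_iff_dvd_diff)
  moreover have "v (x ^ (p - 1) - of_int a ^ (p - 1)) < 1"
  proof -
    define z where "z = x / of_int a"
    have "of_int a \<noteq> (0::'k)" using va by auto
    then have "z - 1 = (x - of_int a) / of_int a" "x = z * of_int a" by (simp_all add: z_def field_simps)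
    then have "v (z - 1) < 1" using a va by (simp add: v_divide)
    then have "v ((z ^ (p - 1) - 1) * of_int a ^ (p - 1)) < 1"
      using power_close_to_one by (simp add: v_mult v_power va)
    then show ?thesis unfolding \<open>x = z * of_int a\<close> by (simp add: power_mult_distrib algebra_simps)
  qed
  ultimately have "v ((x ^ (p - 1) - of_int a ^ (p - 1)) + of_int (a ^ (p - 1) - 1)) < 1"
    by (intro v_ultra_less)
  then show ?thesis by simp
qed

lemma v_root_of_unity:
  assumes "x ^ m = 1" "m > 0" shows "v x = 1"
  using assms by (metis v_power v_one v_nonneg power_eq_1_iff less_irrefl abs_of_nonneg power_eq_imp_eq_base power_one zero_le_one)

text \<open>The power x^(p-1) is still an m-th root of unity and is congruent to 1, hence equal to
  1.\<close>

lemma root_of_unity_order_dvd: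
  fixes x :: 'k
  assumes x: "x ^ m = 1" and m: "m > 0" "\<not> p dvd m"
  shows "x ^ (p - 1) = 1"
proof (rule root_of_unity_prime_to_p[OF _ _ m(2)])
  show "v (x ^ (p - 1) - 1) < 1" using power_p_minus_1_close_to_one v_root_of_unity[OF x m(1)] .
  show "(x ^ (p - 1)) ^ m = 1" by (metis x power_mult mult.commute power_one)
qed

text \<open>Bezout's identity l i = (p - 1) j + 1 writes x as the inverse of a power of x^(p-1), so
  x is congruent to 1. The cases l = p and l prime to p then rest on different estimates.\<close>

lemma no_root_of_unity:
  fixes x :: 'k
  assumes l: "prime l" "\<not> l dvd (p - 1)" and p_odd: "odd p" and x: "x ^ l = 1"
  shows "x = 1"
proof -
  have "coprime l (p - 1)" using l by (simp add: prime_imp_coprime)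
  moreover have "p - 1 \<noteq> 1" using p_odd by (cases "p = 2") auto
  ultimately obtain i j where ij: "l * i = (p - 1) * j + 1"
    using coprime_bezout_strong[of l "p - 1"] by blast
  have vx: "v x = 1" using v_root_of_unity[OF x] l(1) prime_gt_0_nat by blast
  have "(x ^ (p - 1)) ^ j * x = (x ^ l) ^ i"
    by (metis ij power_mult power_add power_one_right)
  then have "(x ^ (p - 1)) ^ j * x = 1" using x by simp
  then have "x - 1 = x * (1 - (x ^ (p - 1)) ^ j)" by (simp add: algebra_simps)
  then have "v (x - 1) = v ((x ^ (p - 1)) ^ j - 1)" using vx v_minus_commute by (metis v_mult mult_1)
  also have "\<dots> < 1" by (intro power_close_to_one power_p_minus_1_close_to_one vx)
  finally have close: "v (x - 1) < 1" .
  show ?thesis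
  proof (cases "l = p")
    case True
    then show ?thesis using p_th_root_of_unity close x p_odd by blast
  next
    case False
    then have "\<not> p dvd l" using l(1) p primes_dvd_imp_eq by blast
    then show ?thesis using root_of_unity_prime_to_p close x by blast
  qed
qed

section \<open>Convergent sequences in K\<close>

definition tends :: "(nat \<Rightarrow> 'k) \<Rightarrow> 'k \<Rightarrow> bool" where
  "tends s L \<longleftrightarrow> (\<lambda>i. v (s i - L)) \<longlonglongrightarrow> 0"

lemma tends_const: "tends (\<lambda>i. c) c"
  by (simp add: tends_def)

lemma tends_bound:
  assumes "\<And>i. v (s i - L) \<le> e i" "e \<longlonglongrightarrow> 0"
  shows "tends s L"
  unfolding tends_def
  by (rule tendsto_sandwich[OF _ _ tendsto_const assms(2)]) (auto simp: assms(1))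

lemma tends_add:
  assumes "tends s L" "tends t M" shows "tends (\<lambda>i. s i + t i) (L + M)"
proof (rule tends_bound)
  show "v (s i + t i - (L + M)) \<le> v (s i - L) + v (t i - M)" for i
    using v_triangle[of "s i - L" "t i - M"] by (simp add: algebra_simps)
  show "(\<lambda>i. v (s i - L) + v (t i - M)) \<longlonglongrightarrow> 0"
    using tendsto_add assms unfolding tends_def by fastforce
qed

lemma tends_mult:
  assumes "tends s L" "tends t M" shows "tends (\<lambda>i. s i * t i) (L * M)"
proof (rule tends_bound)
  fix i
  have "s i * t i - L * M = (s i - L) * (t i - M) + ((s i - L) * M + L * (t i - M))"
    by (simp add: algebra_simps)
  then have "v (s i * t i - L * M) \<le> v ((s i - L) * (t i - M)) + v ((s i - L) * M + L * (t i - M))"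
    using v_triangle by metis
  also have "v ((s i - L) * M + L * (t i - M)) \<le> v (s i - L) * v M + v L * v (t i - M)"
    using v_triangle v_mult by metis
  finally show "v (s i * t i - L * M) \<le> v (s i - L) * v (t i - M) + (v (s i - L) * v M + v L * v (t i - M))"
    by (simp add: v_mult)
next
  note lim = assms[unfolded tends_def]
  from tendsto_add[OF tendsto_mult[OF lim] tendsto_add[OF
      tendsto_mult[OF lim(1) tendsto_const[of "v M"]] tendsto_mult[OF tendsto_const[of "v L"] lim(2)]]]
  show "(\<lambda>i. v (s i - L) * v (t i - M) + (v (s i - L) * v M + v L * v (t i - M))) \<longlonglongrightarrow> 0"
    by (simp only: mult_zero_left mult_zero_right add_0_left)
qed

lemma tends_sum: "(\<And>x. x \<in> A \<Longrightarrow> tends (s x) (L x)) \<Longrightarrow> tends (\<lambda>i. \<Sum>x\<in>A. s x i) (\<Sum>x\<in>A. L x)"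
  by (induction A rule: infinite_finite_induct) (auto intro: tends_add tends_const)

lemma tends_prod: "(\<And>x. x \<in> A \<Longrightarrow> tends (s x) (L x)) \<Longrightarrow> tends (\<lambda>i. \<Prod>x\<in>A. s x i) (\<Prod>x\<in>A. L x)"
  by (induction A rule: infinite_finite_induct) (auto intro: tends_mult tends_const)

lemma tends_v:
  assumes "tends s L" shows "(\<lambda>i. v (s i)) \<longlonglongrightarrow> v L"
proof -
  have le: "\<bar>v (s i) - v L\<bar> \<le> v (s i - L)" for i
    using v_triangle[of "s i - L" L] v_triangle[of "L - s i" "s i"] v_minus_commute[of L "s i"] by auto
  have "(\<lambda>i. v (s i) - v L) \<longlonglongrightarrow> 0"
    by (rule Lim_null_comparison[OF _ assms[unfolded tends_def]]) (simp add: le)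
  then show ?thesis by (simp add: LIM_zero_iff)
qed

end

section \<open>The absolute value of a division algebra over the p-adic numbers\<close>

text \<open>Lagrange's theorem in the quotient group: the order of the coset of g divides m.
  \<open>group_index\<close> counts left cosets, which normality identifies with the right cosets
  forming \<open>H Mod N\<close>.\<close>

lemma index_power_mem:
  assumes G: "is_subgroup G G" "0 \<notin> G" and N: "is_normal_subgroup N G"
    and index: "group_index N G = m" "m > 0" and g: "g \<in> G"
  shows "g ^ m \<in> N"
proof -
  define H where "H = \<lparr>carrier = G, mult = (*), one = (1 :: 'a::division_ring)\<rparr>"
  have sub: "N \<subseteq> G" "1 \<in> N" "\<And>x y. x \<in> N \<Longrightarrow> y \<in> N \<Longrightarrow> x * y \<in> N" "\<And>x. x \<in> N \<Longrightarrow> inverse x \<in> N"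
    and conj: "\<And>h x. h \<in> G \<Longrightarrow> x \<in> N \<Longrightarrow> h * x * inverse h \<in> N"
    using N by (auto simp: is_normal_subgroup_def is_subgroup_def)
  have Gs: "1 \<in> G" "\<And>x y. x \<in> G \<Longrightarrow> y \<in> G \<Longrightarrow> x * y \<in> G" "\<And>x. x \<in> G \<Longrightarrow> inverse x \<in> G"
    using G(1) by (auto simp: is_subgroup_def)
  have "group H"
  proof (rule groupI)
    fix x assume x: "x \<in> carrier H"
    then have "x \<noteq> 0" using G(2) by (auto simp: H_def)
    then show "\<exists>y\<in>carrier H. y \<otimes>\<^bsub>H\<^esub> x = \<one>\<^bsub>H\<^esub>"
      using x Gs by (intro bexI[of _ "inverse x"]) (auto simp: H_def)
  qed (auto simp: H_def Gs mult.assoc)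
  then interpret H: group H .
  have inv: "inv\<^bsub>H\<^esub> x = inverse x" if "x \<in> G" for x
  proof -
    have "x \<noteq> 0" using that G(2) by auto
    then show ?thesis using that Gs by (intro H.inv_equality) (auto simp: H_def)
  qed
  have "subgroup N H"
    by (rule H.subgroupI) (use sub inv in \<open>auto simp: H_def\<close>)
  then have "N \<lhd> H"
    unfolding H.normal_inv_iff using conj inv by (auto simp: H_def)
  then interpret N: normal N H .
  interpret F: group "H Mod N" by (rule N.factorgroup_is_group)
  have coset: "N #>\<^bsub>H\<^esub> x = {x * y |y. y \<in> N}" if "x \<in> G" for x
  proof -
    have "N #>\<^bsub>H\<^esub> x = x <#\<^bsub>H\<^esub> N" using N.coset_eq that by (auto simp: H_def)
    then show ?thesis by (auto simp: l_coset_def H_def)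
  qed
  have "carrier (H Mod N) = {{x * y |y. y \<in> N} |x. x \<in> G}"
    using coset by (auto simp: FactGroup_def RCOSETS_def H_def)
  then have order: "order (H Mod N) = m"
    using index by (simp add: order_def group_index_def)
  have pow: "x [^]\<^bsub>H\<^esub> (k::nat) = x ^ k" for x k
    by (induction k) (auto simp: H_def power_Suc2 simp del: power_Suc)
  have gH: "g \<in> carrier H" using g by (simp add: H_def)
  then have gF: "N #>\<^bsub>H\<^esub> g \<in> carrier (H Mod N)" by (auto simp: FactGroup_def RCOSETS_def)
  have "N #>\<^bsub>H\<^esub> (g [^]\<^bsub>H\<^esub> m) = (N #>\<^bsub>H\<^esub> g) [^]\<^bsub>H Mod N\<^esub> m"
    by (rule hom_nat_pow[OF N.r_coset_hom_Mod gH H.is_group F.is_group])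
  also have "\<dots> = \<one>\<^bsub>H Mod N\<^esub>" using F.pow_order_eq_1[OF gF] by (simp add: order)
  also have "\<dots> = N" by (simp add: FactGroup_def)
  finally have "N #>\<^bsub>H\<^esub> (g ^ m) = N" by (simp add: pow)
  moreover have "g ^ m \<in> carrier H" using H.nat_pow_closed[OF gH, of m] by (simp add: pow)
  ultimately show ?thesis using H.coset_join1[OF _ _ \<open>subgroup N H\<close>] by blast
qed

locale padic_division_algebra = Qp p v + central_division_algebra_no_roots sm b l
  for p :: nat and v :: "'k::field_char_0 \<Rightarrow> real"
    and sm :: "'k \<Rightarrow> 'd::division_ring \<Rightarrow> 'd" and b :: "nat \<Rightarrow> 'd" and l :: nat
begin

definition dtends :: "(nat \<Rightarrow> 'd) \<Rightarrow> 'd \<Rightarrow> bool" where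
  "dtends s x \<longleftrightarrow> (\<forall>j<l ^ 2. tends (\<lambda>i. coords sm b (l ^ 2) (s i) j) (coords sm b (l ^ 2) x j))"

text \<open>On scalars this is the l^2-th power of v, so the absolute value of D extending v is the
  l^2-th root of w. Omitting the root changes neither the unit ball nor the ultrametric
  inequality.\<close>

definition w :: "'d \<Rightarrow> real" where
  "w x = v (nrm x)"

lemma w_nonneg [simp]: "w x \<ge> 0"
  by (simp add: w_def)

lemma w_eq_0_iff [simp]: "w x = 0 \<longleftrightarrow> x = 0"
  by (simp add: w_def)

lemma w_zero [simp]: "w 0 = 0"
  by simp

lemma w_mult: "w (x * y) = w x * w y"
  by (simp add: w_def nrm_mult v_mult)

lemma w_one [simp]: "w 1 = 1"
  by (simp add: w_def)

lemma w_power: "w (x ^ k) = w x ^ k"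
  by (simp add: w_def nrm_power v_power)

lemma w_inverse: "w (inverse x) = inverse (w x)"
  by (simp add: w_def nrm_inverse v_inverse)

lemma w_sm: "w (sm a x) = v a ^ (l ^ 2) * w x"
  by (simp add: w_def nrm_sm v_mult v_power)

lemma w_minus [simp]: "w (- x) = w x"
proof -
  have "- x = sm (- 1) x" by (simp add: sm_one)
  then show ?thesis by (simp add: w_sm del: V.scale_minus_left)
qed

lemma w_minus_commute: "w (x - y) = w (y - x)"
  by (metis minus_diff_eq w_minus)

lemma l2_pos: "0 < l ^ 2"
  using l_gt_1 by simp

lemma w_of_int: "w (of_int a) = v (of_int a) ^ (l ^ 2)"
  using w_sm[of "of_int a" 1] by (simp add: sm_of_int)

lemma w_of_nat: "w (of_nat a) = v (of_nat a) ^ (l ^ 2)"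
  using w_of_int[of "int a"] by simp

lemma w_of_int_le_1: "w (of_int a) \<le> 1"
  by (simp add: w_of_int power_le_one v_of_int_le_1)

lemma w_of_nat_le_1: "w (of_nat a) \<le> 1"
  using w_of_int_le_1[of "int a"] by simp

lemma power_l2_less_1: "0 \<le> t \<Longrightarrow> t < 1 \<Longrightarrow> t ^ (l ^ 2) < (1::real)"
proof -
  assume "0 \<le> t" "t < 1"
  then show "t ^ (l ^ 2) < 1" using power_strict_mono[of t 1 "l ^ 2"] l2_pos by simp
qed

lemma w_of_int_less_1: "int p dvd a \<Longrightarrow> w (of_int a) < 1"
  unfolding w_of_int by (intro power_l2_less_1 v_of_int_lt_1) auto

lemma w_p_less_1: "w (of_nat p) < 1"
  using w_of_int_less_1[of "int p"] by simp

section \<open>Continuity of w and compactness of its unit ball\<close>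

lemma dtends_add: "dtends s x \<Longrightarrow> dtends t y \<Longrightarrow> dtends (\<lambda>i. s i + t i) (x + y)"
  unfolding dtends_def by (auto simp: coords_add intro: tends_add)

lemma dtends_sm: "dtends s x \<Longrightarrow> dtends (\<lambda>i. sm a (s i)) (sm a x)"
  unfolding dtends_def by (auto simp: coords_sm intro: tends_mult tends_const)

lemma dtends_const: "dtends (\<lambda>i. x) x"
  unfolding dtends_def by (auto intro: tends_const)

lemma dtends_diff: "dtends s x \<Longrightarrow> dtends (\<lambda>i. s i - x) 0"
  using dtends_add[OF _ dtends_const[of "- x"], of s x] by simp

lemma coords_mult_left:
  "coords sm b (l ^ 2) (x * y) i = (\<Sum>k<l ^ 2. coords sm b (l ^ 2) x k * coords sm b (l ^ 2) (b k * y) i)"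
proof -
  have "x * y = (\<Sum>k<l ^ 2. sm (coords sm b (l ^ 2) x k) (b k)) * y" by (simp only: coords_sum)
  also have "\<dots> = (\<Sum>k<l ^ 2. sm (coords sm b (l ^ 2) x k) (b k * y))"
    by (simp only: sum_distrib_right sm_mult_left)
  finally show ?thesis by (simp only: coords_sum_fun[OF finite_lessThan] coords_sm)
qed

text \<open>By the Leibniz formula the determinant is a polynomial in the coordinates of x.\<close>

lemma w_tends:
  assumes "dtends s x" shows "(\<lambda>i. w (s i)) \<longlonglongrightarrow> w x"
proof -
  let ?n = "l ^ 2"
  have nrm_eq: "nrm y = (\<Sum>\<pi>\<in>{\<pi>. \<pi> permutes {0..<?n}}.
      signof \<pi> * (\<Prod>i = 0..<?n. lmult_mat sm b ?n y $$ (i, \<pi> i)))" for y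
    by (rule trans[OF nrm_def det_def'[OF lmult_carrier]])
  have "tends (\<lambda>k. \<Sum>\<pi>\<in>{\<pi>. \<pi> permutes {0..<?n}}.
        signof \<pi> * (\<Prod>i = 0..<?n. lmult_mat sm b ?n (s k) $$ (i, \<pi> i)))
      (\<Sum>\<pi>\<in>{\<pi>. \<pi> permutes {0..<?n}}.
        signof \<pi> * (\<Prod>i = 0..<?n. lmult_mat sm b ?n x $$ (i, \<pi> i)))"
  proof (rule tends_sum, rule tends_mult[OF tends_const], rule tends_prod)
    fix \<pi> i assume "\<pi> \<in> {\<pi>. \<pi> permutes {0..<?n}}" and i: "i \<in> {0..<?n}"
    then have \<pi>: "\<pi> i < ?n" by (metis atLeastLessThan_iff mem_Collect_eq permutes_in_image)
    have "tends (\<lambda>k. coords sm b ?n (s k * b (\<pi> i)) i) (coords sm b ?n (x * b (\<pi> i)) i)"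
      unfolding coords_mult_left[of "s _" "b (\<pi> i)"] coords_mult_left[of x "b (\<pi> i)"]
      by (intro tends_sum tends_mult tends_const) (use assms in \<open>auto simp: dtends_def\<close>)
    then show "tends (\<lambda>k. lmult_mat sm b ?n (s k) $$ (i, \<pi> i)) (lmult_mat sm b ?n x $$ (i, \<pi> i))"
      using i \<pi> by (simp add: lmult_index)
  qed
  then have "tends (\<lambda>k. nrm (s k)) (nrm x)" by (simp only: nrm_eq)
  then show ?thesis unfolding w_def by (rule tends_v)
qed

lemma w_tends_diff: "dtends s x \<Longrightarrow> (\<lambda>i. w (s i - x)) \<longlonglongrightarrow> 0"
  using w_tends[OF dtends_diff] by simp

lemma ex_dtends_subseq:
  assumes "\<And>i j. j < l ^ 2 \<Longrightarrow> v (coords sm b (l ^ 2) (s i) j) \<le> 1"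
  shows "\<exists>r x. strict_mono (r :: nat \<Rightarrow> nat) \<and> dtends (\<lambda>i. s (r i)) x"
proof -
  obtain r L where r: "strict_mono (r :: nat \<Rightarrow> nat)"
      "\<forall>j<l ^ 2. (\<lambda>i. v (coords sm b (l ^ 2) (s (r i)) j - L j)) \<longlonglongrightarrow> 0"
    using seq_compact_vector[of "l ^ 2" "\<lambda>i. coords sm b (l ^ 2) (s i)"] assms by blast
  have "dtends (\<lambda>i. s (r i)) (\<Sum>j<l ^ 2. sm (L j) (b j))"
    unfolding dtends_def using r(2) by (simp add: coords_combination tends_def)
  with r(1) show ?thesis by blast
qed

text \<open>Were \<open>w\<close> not bounded below on the unit sphere, a limit of normalized elements would be a
  nonzero element of norm \<open>0\<close>.\<close>
lemma w_unit_ball_bounded: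
  "\<exists>N. \<forall>x. w x \<le> 1 \<longrightarrow> (\<forall>j<l ^ 2. v (coords sm b (l ^ 2) x j) \<le> real p ^ N)"
proof (rule ccontr)
  let ?n = "l ^ 2"
  let ?c = "coords sm b ?n"
  assume "\<not> ?thesis"
  then have "\<forall>N. \<exists>x. w x \<le> 1 \<and> (\<exists>j<?n. v (?c x j) > real p ^ N)" by (metis not_le)
  then obtain x where x: "\<And>N. w (x N) \<le> 1" "\<And>N. \<exists>j<?n. v (?c (x N) j) > real p ^ N" by metis
  have "\<exists>j<?n. \<forall>k<?n. v (?c (x N) k) \<le> v (?c (x N) j)" for N
  proof -
    have "v (?c (x N) 0) \<in> (\<lambda>j. v (?c (x N) j)) ` {..<?n}" using l2_pos by (intro imageI) simp
    then have ne: "(\<lambda>j. v (?c (x N) j)) ` {..<?n} \<noteq> {}" by blast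
    then have "Max ((\<lambda>j. v (?c (x N) j)) ` {..<?n}) \<in> (\<lambda>j. v (?c (x N) j)) ` {..<?n}"
      by (intro Max_in) auto
    then obtain j where j: "j < ?n" "v (?c (x N) j) = Max ((\<lambda>j. v (?c (x N) j)) ` {..<?n})" by auto
    then show ?thesis by (intro exI[of _ j]) auto
  qed
  then obtain m where m: "\<And>N. m N < ?n" "\<And>N k. k < ?n \<Longrightarrow> v (?c (x N) k) \<le> v (?c (x N) (m N))"
    by metis
  define a where "a N = ?c (x N) (m N)" for N
  have a: "v (a N) > real p ^ N" for N
    using x(2)[of N] m(2)[of _ N] unfolding a_def by fastforce
  have pN: "real p ^ N \<ge> 1" for N using p_gt_1 by simp
  have a1: "v (a N) > 1" for N using a[of N] pN[of N] by linarith
  then have a0: "a N \<noteq> 0" for N by (metis not_one_less_zero v_zero)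
  \<comment> \<open>Dividing by the largest coordinate leaves all coordinates at most 1 and one of
    them equal to 1, while w shrinks to at most p^-N.\<close>
  define z where "z N = sm (inverse (a N)) (x N)" for N
  have cz: "?c (z N) j = inverse (a N) * ?c (x N) j" for N j by (simp add: z_def coords_sm)
  have "v (?c (z N) j) \<le> 1" if "j < ?n" for N j
  proof -
    have "inverse (v (a N)) * v (?c (x N) j) \<le> inverse (v (a N)) * v (a N)"
      using m(2)[OF that, of N] by (intro mult_left_mono) (auto simp: a_def)
    also have "\<dots> = 1" using a0[of N] by simp
    finally show ?thesis by (simp only: cz v_mult v_inverse)
  qed
  then obtain r y where r: "strict_mono (r :: nat \<Rightarrow> nat)" "dtends (\<lambda>i. z (r i)) y"
    using ex_dtends_subseq[of z] by blast
  have wz: "w (z N) \<le> (1 / p) ^ N" for N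
  proof -
    have "w (z N) = inverse (v (a N)) ^ ?n * w (x N)" by (simp add: z_def w_sm v_inverse)
    also have "\<dots> \<le> inverse (v (a N)) ^ ?n * 1" using x(1) a1[of N] by (intro mult_left_mono) auto
    also have "\<dots> \<le> inverse (v (a N)) ^ 1 * 1"
      using a1[of N] l2_pos by (intro mult_right_mono power_decreasing) (auto simp: inverse_le_1_iff)
    also have "\<dots> \<le> inverse (real p ^ N)" using le_imp_inverse_le[of "real p ^ N" "v (a N)"] a[of N] p_gt_1 by simp
    finally show ?thesis by (simp add: power_one_over inverse_eq_divide)
  qed
  have lim: "(\<lambda>i. (1 / real p) ^ r i) \<longlonglongrightarrow> 0"
    using LIMSEQ_subseq_LIMSEQ[OF LIMSEQ_realpow_zero[of "1 / real p"] r(1)] p_gt_1 by (simp add: o_def)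
  have "(\<lambda>i. w (z (r i))) \<longlonglongrightarrow> 0"
    by (rule tendsto_sandwich[OF _ _ tendsto_const lim]) (auto simp: wz)
  then have "w y = 0" using w_tends[OF r(2)] LIMSEQ_unique by blast
  then have "y = 0" by simp
  \<comment> \<open>The position \<open>m (r i)\<close> of the coordinate 1 varies with i, so all
    coordinates must fall below 1 simultaneously.\<close>
  have "\<forall>j<?n. eventually (\<lambda>i. v (?c (z (r i)) j) < 1) sequentially"
  proof (intro allI impI)
    fix j assume "j < ?n"
    then have "(\<lambda>i. v (?c (z (r i)) j)) \<longlonglongrightarrow> 0"
      using r(2) \<open>y = 0\<close> unfolding dtends_def tends_def by (simp add: coords_zero)
    then show "eventually (\<lambda>i. v (?c (z (r i)) j) < 1) sequentially"
      by (rule order_tendstoD) simp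
  qed
  then have "eventually (\<lambda>i. \<forall>j\<in>{..<?n}. v (?c (z (r i)) j) < 1) sequentially"
    by (intro eventually_ball_finite) auto
  then obtain i where "\<forall>j\<in>{..<?n}. v (?c (z (r i)) j) < 1" by (auto simp: eventually_sequentially)
  then have "v (?c (z (r i)) (m (r i))) < 1" using m(1) by auto
  moreover have "?c (z (r i)) (m (r i)) = 1" using a0[of "r i"] by (simp add: cz a_def)
  ultimately show False by simp
qed

lemma ex_dtends_subseq_w:
  assumes s: "\<And>i. w (s i) \<le> 1"
  shows "\<exists>r x. strict_mono (r :: nat \<Rightarrow> nat) \<and> dtends (\<lambda>i. s (r i)) x"
proof -
  obtain N where N: "\<And>x j. w x \<le> 1 \<Longrightarrow> j < l ^ 2 \<Longrightarrow> v (coords sm b (l ^ 2) x j) \<le> real p ^ N"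
    using w_unit_ball_bounded by blast
  define a :: 'k where "a = of_nat p ^ N"
  have a: "a \<noteq> 0" "v a = (1 / p) ^ N" using p_gt_1 by (auto simp: a_def v_power v_p)
  have "v (coords sm b (l ^ 2) (sm a (s i)) j) \<le> 1" if "j < l ^ 2" for i j
  proof -
    have "v (coords sm b (l ^ 2) (sm a (s i)) j) \<le> (1 / p) ^ N * real p ^ N"
      unfolding coords_sm v_mult a(2) using N[OF s that] by (intro mult_left_mono) auto
    also have "\<dots> = 1" using p_gt_1 by (simp flip: power_mult_distrib)
    finally show ?thesis .
  qed
  then obtain r y where r: "strict_mono (r :: nat \<Rightarrow> nat)" "dtends (\<lambda>i. sm a (s (r i))) y"
    using ex_dtends_subseq[of "\<lambda>i. sm a (s i)"] by blast
  have "dtends (\<lambda>i. s (r i)) (sm (inverse a) y)"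
    using dtends_sm[OF r(2), of "inverse a"] a(1) by simp
  with r(1) show ?thesis by blast
qed

lemma w_ultra: "w (x + y) \<le> max (w x) (w y)"
proof -
  \<comment> \<open>Dividing by the larger summand reduces every sum to x + 1 with w x at most 1.
    There a sequence with unbounded values would have a convergent subsequence, on which w is
    bounded by continuity.\<close>
  have "\<exists>A. \<forall>x. w x \<le> 1 \<longrightarrow> w (x + 1) \<le> A"
  proof (rule ccontr)
    assume "\<not> ?thesis"
    then have "\<forall>k::nat. \<exists>x. w x \<le> 1 \<and> w (x + 1) > real k" by (metis not_le)
    then obtain s where s: "\<And>k. w (s k) \<le> 1" "\<And>k. w (s k + 1) > real k" by metis
    obtain r x where r: "strict_mono (r :: nat \<Rightarrow> nat)" "dtends (\<lambda>i. s (r i)) x"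
      using ex_dtends_subseq_w[of s] s by blast
    have "(\<lambda>i. w (s (r i) + 1)) \<longlonglongrightarrow> w (x + 1)"
      by (intro w_tends dtends_add r dtends_const)
    then have "bounded (range (\<lambda>i. w (s (r i) + 1)))" by (rule convergent_imp_bounded)
    then obtain B where B: "\<And>i. \<bar>w (s (r i) + 1)\<bar> \<le> B" by (auto simp: bounded_iff)
    obtain i :: nat where "B < real i" using reals_Archimedean2 by blast
    also have "real i \<le> real (r i)" using strict_mono_imp_increasing[OF r(1)] by simp
    also have "\<dots> < w (s (r i) + 1)" by (rule s)
    finally show False using B[of i] by simp
  qed
  then obtain A0 where A0: "\<And>x. w x \<le> 1 \<Longrightarrow> w (x + 1) \<le> A0" by blast
  define A where "A = max 1 A0"
  have A: "w (x + 1) \<le> A" if "w x \<le> 1" for x using A0[OF that] by (simp add: A_def)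
  have le: "w (x + y) \<le> A * w y" if "w x \<le> w y" "y \<noteq> 0" for x y
  proof -
    have wy: "w y > 0" using that(2) w_nonneg[of y] w_eq_0_iff[of y] by linarith
    have "w (x * inverse y) \<le> 1" unfolding w_mult w_inverse using that(1) wy by (simp add: field_simps)
    then have "w (x * inverse y + 1) * w y \<le> A * w y" using A wy by (intro mult_right_mono) auto
    moreover have "(x * inverse y + 1) * y = x + y" using that(2) by (simp add: distrib_right mult.assoc)
    ultimately show ?thesis by (simp flip: w_mult)
  qed
  have "w (x + y) \<le> A * max (w x) (w y)" for x y
  proof -
    have A1: "A \<ge> 1" by (simp add: A_def)
    consider "y = 0" | "x = 0" | "w x \<le> w y" "y \<noteq> 0" | "w y \<le> w x" "x \<noteq> 0" by linarith
    then show ?thesis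
    proof cases
      case 1
      then show ?thesis using A1 mult_right_mono[of 1 A "w x"] by simp
    next
      case 2
      then show ?thesis using A1 mult_right_mono[of 1 A "w y"] by simp
    next
      case 3
      then show ?thesis using le[of x y] by simp
    next
      case 4
      then show ?thesis using le[of y x] by (simp add: add.commute max_def)
    qed
  qed
  moreover have "A \<ge> 1" by (simp add: A_def)
  ultimately show ?thesis
    by (intro ultrametric_if_quasi_ultrametric[of w A] w_mult w_of_nat_le_1) auto
qed

lemma w_ultra_less: "w x < e \<Longrightarrow> w y < e \<Longrightarrow> w (x + y) < e"
  using w_ultra[of x y] by linarith

lemma w_ultra_diff_less: "w x < e \<Longrightarrow> w y < e \<Longrightarrow> w (x - y) < e"
  using w_ultra[of x "- y"] by simp

lemma w_ultra_le: "w x \<le> e \<Longrightarrow> w y \<le> e \<Longrightarrow> w (x + y) \<le> e"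
  using w_ultra[of x y] by linarith

lemma w_ultra_diff_le: "w x \<le> e \<Longrightarrow> w y \<le> e \<Longrightarrow> w (x - y) \<le> e"
  using w_ultra[of x "- y"] by simp

lemma w_sum_le: "e \<ge> 0 \<Longrightarrow> (\<And>i. i \<in> A \<Longrightarrow> w (f i) \<le> e) \<Longrightarrow> w (\<Sum>i\<in>A. f i) \<le> e"
  by (induction A rule: infinite_finite_induct) (auto intro: w_ultra_le)

lemma w_eq_1_if_close:
  assumes "w (x - 1) < 1" shows "w x = 1"
proof (rule antisym)
  show "w x \<le> 1" using w_ultra_le[of "x - 1" 1 1] assms by simp
  show "w x \<ge> 1" using w_ultra_less[of "1 - x" 1 x] assms w_minus_commute[of x 1] by force
qed

lemma w_power_close:
  assumes "w (x - 1) < 1" shows "w (x ^ k - 1) < 1"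
proof (induction k)
  case (Suc k)
  have "w ((x ^ k - 1) * x) < 1" using Suc w_eq_1_if_close[OF assms] by (simp add: w_mult)
  then have "w ((x ^ k - 1) * x + (x - 1)) < 1" using assms by (rule w_ultra_less)
  then show ?case by (simp add: algebra_simps power_Suc2 del: power_Suc)
qed simp

lemma w_power_diff:
  assumes "w x \<le> 1" "w y \<le> 1" shows "w (x ^ k - y ^ k) \<le> w (x - y)"
proof (induction k)
  case (Suc k)
  have eq: "x ^ Suc k - y ^ Suc k = x ^ k * (x - y) + (x ^ k - y ^ k) * y"
    by (simp add: algebra_simps power_Suc2 del: power_Suc)
  have "w ((x ^ k - y ^ k) * y) \<le> w (x ^ k - y ^ k) * 1"
    unfolding w_mult using assms(2) by (intro mult_left_mono) auto
  then have "w ((x ^ k - y ^ k) * y) \<le> w (x - y)" using Suc by simp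
  moreover have "w (x ^ k * (x - y)) \<le> w (x - y)"
    using assms(1) by (simp add: w_mult w_power mult_left_le_one_le power_le_one)
  ultimately show ?case unfolding eq by (intro w_ultra_le)
qed simp

section \<open>The p-th power map near 1\<close>

lemma sm_of_nat_mult: "sm (of_nat c) x = of_nat c * x"
  by (metis sm_of_nat sm_one_mult(1))

text \<open>The identity holds in the commutative ring K[X] and is carried to D by evaluation at
  y.\<close>

lemma power_binomial: "(1 + y) ^ N = (\<Sum>k\<le>N. of_nat (N choose k) * y ^ k)" for y :: 'd
proof -
  have ev1: "ev y [:1, 1:] = 1 + y" by (simp add: ev_pCons sm_one)
  have ev_power: "ev y (f ^ k) = ev y f ^ k" for f k
  proof (induction k)
    case 0
    show ?case by (simp add: one_pCons ev_pCons sm_one)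
  qed (simp add: ev_mult)
  have eq: "[:1, 1:] = [:0, 1:] + (1 :: 'k poly)" by (simp add: one_pCons)
  have "(1 + y) ^ N = ev y ([:1, 1:] ^ N)" by (simp add: ev_power ev1)
  also have "[:1, 1:] ^ N = (\<Sum>k\<le>N. of_nat (N choose k) * [:0, 1 :: 'k:] ^ k)"
    unfolding eq by (simp add: binomial_ring)
  also have "ev y \<dots> = (\<Sum>k\<le>N. of_nat (N choose k) * y ^ k)"
    by (simp add: ev_sum ev_smult ev_power of_nat_poly ev_pCons sm_one sm_of_nat_mult)
  finally show ?thesis .
qed

text \<open>The inner binomial coefficients are divisible by p, and each inner term has a factor y.
  Keeping \<open>w y\<close> on the right is what makes \<open>w_power_p_power_close\<close> a
  contraction.\<close>

lemma w_middle_terms: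
  assumes "w y \<le> 1"
  shows "w ((1 + y) ^ p - 1 - y ^ p) \<le> w (of_nat p) * w y"
proof -
  have eq: "{..p} = insert 0 (insert p {0<..<p})" using p_gt_1 by auto
  have "(1 + y) ^ p - 1 - y ^ p = (\<Sum>k\<in>{0<..<p}. of_nat (p choose k) * y ^ k)"
    unfolding power_binomial eq using p_gt_1 by simp
  also have "w \<dots> \<le> w (of_nat p) * w y"
  proof (rule w_sum_le)
    fix k assume k: "k \<in> {0<..<p}"
    then have "p dvd (p choose k)" using p by (intro dvd_choose_prime) auto
    then obtain c where c: "p choose k = p * c" by auto
    obtain k' where k': "k = Suc k'" using k by (cases k) auto
    have "w (of_nat (p choose k) * y ^ k) = w (of_nat p) * (w (of_nat c) * (w y * w y ^ k'))"
      unfolding c unfolding k' by (simp add: w_mult w_power mult.assoc)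
    also have "\<dots> \<le> w (of_nat p) * (1 * (w y * 1))"
      using assms w_of_nat_le_1 by (intro mult_mono mult_left_mono power_le_one) auto
    finally show "w (of_nat (p choose k) * y ^ k) \<le> w (of_nat p) * w y" by simp
  qed simp
  finally show ?thesis .
qed

text \<open>Modulo {w < 1} the p-th power map is additive on the powers of x, so (x - 1)^p is
  congruent to x^p - 1; multiplicativity of w excludes nilpotent residues.\<close>

lemma close_if_power_p_close:
  assumes x: "w x \<le> 1" and close: "w (x ^ p - 1) < 1"
  shows "w (x - 1) < 1"
proof (rule ccontr)
  assume not: "\<not> w (x - 1) < 1"
  define y where "y = x - 1"
  have y: "w y \<le> 1" unfolding y_def using x by - (rule w_ultra_diff_le, auto)
  have "w ((1 + y) ^ p - 1 - y ^ p) \<le> w (of_nat p) * w y" by (rule w_middle_terms[OF y])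
  also have "\<dots> < 1" using w_p_less_1 y by (metis mult_left_le order_le_less_trans w_nonneg)
  finally have "w ((x ^ p - 1) - ((1 + y) ^ p - 1 - y ^ p)) < 1"
    by (rule w_ultra_diff_less[OF close])
  then have "w y ^ p < 1" by (simp add: y_def flip: w_power)
  moreover have "w y \<ge> 1" using not by (simp add: y_def)
  ultimately show False using one_le_power[of "w y" p] by linarith
qed

lemma close_if_power_p_power_close:
  assumes x: "w x \<le> 1" and close: "w (x ^ (p ^ k) - 1) < 1"
  shows "w (x - 1) < 1"
  using assms
proof (induction k arbitrary: x)
  case (Suc k)
  have "w ((x ^ p) ^ (p ^ k) - 1) < 1" using Suc.prems(2) by (simp flip: power_mult)
  moreover have "w (x ^ p) \<le> 1" using Suc.prems(1) by (simp add: w_power power_le_one)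
  ultimately have "w (x ^ p - 1) < 1" using Suc.IH[of "x ^ p"] by simp
  then show ?case by (rule close_if_power_p_close[OF Suc.prems(1)])
qed simp

text \<open>Each p-th power brings a gain of c: the inner terms gain it from p, and y^p gains it
  from a second factor y.\<close>

lemma w_power_p_power_close:
  assumes x: "w (x - 1) \<le> c" and c: "w (of_nat p) \<le> c" "c < 1"
  shows "w (x ^ (p ^ k) - 1) \<le> c ^ Suc k"
proof (induction k)
  case (Suc k)
  define z where "z = x ^ (p ^ k)"
  define y where "y = z - 1"
  have c0: "c \<ge> 0" using c(1) w_nonneg order_trans by blast
  have y: "w y \<le> c ^ Suc k" using Suc by (simp add: y_def z_def)
  also have "\<dots> \<le> c" using c c0 by (simp add: mult_left_le power_le_one)
  finally have yc: "w y \<le> c" .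
  then have y1: "w y \<le> 1" using c by simp
  have "w ((1 + y) ^ p - 1 - y ^ p) \<le> c * w y"
    using w_middle_terms[OF y1] c(1) mult_right_mono[of "w (of_nat p)" c "w y"] by simp
  moreover have "w (y ^ p) \<le> c * w y"
  proof -
    have "w (y ^ p) = w y ^ p" by (rule w_power)
    also have "\<dots> \<le> w y ^ 2" using p_gt_1 y1 by (intro power_decreasing) auto
    also have "\<dots> \<le> c * w y" unfolding power2_eq_square using yc by (intro mult_right_mono) auto
    finally show ?thesis .
  qed
  ultimately have "w (((1 + y) ^ p - 1 - y ^ p) + y ^ p) \<le> c * w y" by (rule w_ultra_le)
  then have "w (z ^ p - 1) \<le> c * w y" by (simp add: y_def)
  also have "\<dots> \<le> c * c ^ Suc k" using y c0 by (intro mult_left_mono) auto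
  finally show ?case by (simp add: z_def mult.commute flip: power_mult)
qed (use x in simp)

section \<open>The residues are not all represented by integers\<close>

lemma ex_uniformizer: "\<exists>u. u \<noteq> 0 \<and> w u < 1 \<and> (\<forall>x. w x < 1 \<longrightarrow> w x \<le> w u)"
proof -
  have value_eq: "\<exists>j>0. w x = real p powr - real j" if x: "x \<noteq> 0" "w x < 1" for x
  proof -
    obtain k :: int where k: "w x = real p powr k"
      using ex_value[of "nrm x"] x(1) by (auto simp: w_def)
    have "k < 0"
    proof (rule ccontr)
      assume "\<not> k < 0"
      then have "real p powr k \<ge> 1" using p_gt_1 by (intro ge_one_powr_ge_zero) auto
      then show False using k x by simp
    qed
    then show ?thesis using k by (intro exI[of _ "nat (- k)"]) auto
  qed
  \<comment> \<open>The values of w are values of v, hence integer powers of p, so the largest value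
    below 1 belongs to the least exponent j. The element p shows that there is such a j.\<close>
  define P where "P j \<longleftrightarrow> (\<exists>x. x \<noteq> 0 \<and> w x < 1 \<and> w x = real p powr - real j)" for j
  have "w (of_nat p) \<noteq> 0" using p_gt_1 by (simp add: w_of_nat v_p del: w_eq_0_iff)
  then have "(of_nat p :: 'd) \<noteq> 0" by auto
  then have "\<exists>j. P j" using value_eq w_p_less_1 unfolding P_def by blast
  then have "P (LEAST j. P j)" by (rule LeastI_ex)
  then obtain u where u: "u \<noteq> 0" "w u < 1" "w u = real p powr - real (LEAST j. P j)" unfolding P_def by blast
  have "w x \<le> w u" if less: "w x < 1" for x
  proof (cases "x = 0")
    case False
    then obtain j where j: "w x = real p powr - real j" using value_eq[OF False less] by blast
    then have "P j" using False less unfolding P_def by blast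
    then have "(LEAST j. P j) \<le> j" by (rule Least_le)
    then show ?thesis unfolding j u(3) using p_gt_1 by (intro powr_mono) auto
  qed simp
  with u show ?thesis by blast
qed

text \<open>If every residue class contained an integer, then \<open>x = \<Sum> a\<^sub>i u\<^sup>i\<close> with integers \<open>a\<^sub>i\<close> for
  every integral \<open>x\<close>, and the algebra would be commutative.\<close>
lemma ex_residue_not_integer: "\<exists>\<theta>. w \<theta> \<le> 1 \<and> (\<forall>a::int. w (\<theta> - of_int a) \<ge> 1)"
proof (rule ccontr)
  assume "\<not> ?thesis"
  then have int: "\<And>x. w x \<le> 1 \<Longrightarrow> \<exists>a::int. w (x - of_int a) < 1" by (metis not_le)
  obtain u where u: "u \<noteq> 0" "w u < 1" "\<And>x. w x < 1 \<Longrightarrow> w x \<le> w u" using ex_uniformizer by blast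
  have wu: "w u > 0" using u(1) w_nonneg[of u] w_eq_0_iff[of u] by linarith
  have gen: "V.subspace (generated u)" "1 \<in> generated u"
    "\<And>x y. x \<in> generated u \<Longrightarrow> y \<in> generated u \<Longrightarrow> x * y \<in> generated u"
    using subdiv_generated[of u] by (auto simp: subdiv_def)
  have expand: "\<exists>y z. x = y + u ^ k * z \<and> w z \<le> 1 \<and> y \<in> generated u" if "w x \<le> 1" for x k
    using that
  proof (induction k arbitrary: x)
    case 0
    then show ?case using V.subspace_0[OF gen(1)] by (intro exI[of _ 0] exI[of _ x]) auto
  next
    case (Suc k)
    obtain a :: int where a: "w (x - of_int a) < 1" using int[OF Suc.prems] by blast
    define x1 where "x1 = inverse u * (x - of_int a)"
    have "w x1 \<le> 1" unfolding x1_def w_mult w_inverse using u(3)[OF a] wu by (simp add: field_simps)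
    then obtain y z where yz: "x1 = y + u ^ k * z" "w z \<le> 1" "y \<in> generated u" using Suc.IH by blast
    have "u * x1 = x - of_int a" using u(1) by (simp add: x1_def flip: mult.assoc)
    then have "x = (of_int a + u * y) + u ^ Suc k * z"
      by (simp add: yz(1) algebra_simps)
    moreover have "of_int a + u * y \<in> generated u"
    proof (rule V.subspace_add[OF gen(1)])
      show "of_int a \<in> generated u" using V.subspace_scale[OF gen(1,2), of "of_int a"] by (simp add: sm_of_int)
      show "u * y \<in> generated u" by (rule gen(3)[OF x_mem_generated yz(3)])
    qed
    ultimately show ?case using yz(2) by blast
  qed
  \<comment> \<open>If t commutes with \<open>generated u\<close>, then the expansion of x gives t x
    - x t = u^k (t z - z t) for every k, so the commutator vanishes. This is used first for t = u;
    then every integral t commutes with u, and it applies to t.\<close>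
  have commute: "t * x = x * t"
    if t: "w t \<le> 1" "t * u = u * t" "\<And>y. y \<in> generated u \<Longrightarrow> t * y = y * t" and x: "w x \<le> 1" for t x
  proof -
    have "w (t * x - x * t) \<le> w u ^ k" for k
    proof -
      obtain y z where yz: "x = y + u ^ k * z" "w z \<le> 1" "y \<in> generated u" using expand[OF x] by blast
      have tu: "t * u ^ k = u ^ k * t" by (rule power_commuting_commutes[OF t(2)[symmetric], symmetric])
      have "t * (u ^ k * z) = u ^ k * (t * z)" by (simp add: tu flip: mult.assoc)
      then have "t * x - x * t = u ^ k * (t * z - z * t)"
        using t(3)[OF yz(3)] by (simp add: yz(1) algebra_simps)
      moreover have "w (t * z - z * t) \<le> 1"
        using t(1) yz(2) by - (rule w_ultra_diff_le, auto simp: w_mult intro: mult_le_one)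
      ultimately show ?thesis by (simp add: w_mult w_power mult_left_le)
    qed
    moreover have "(\<lambda>k. w u ^ k) \<longlonglongrightarrow> 0" using u(2) by (intro LIMSEQ_realpow_zero) auto
    ultimately have "w (t * x - x * t) \<le> 0" by (intro LIMSEQ_le_const[of "\<lambda>k. w u ^ k"]) auto
    then have "w (t * x - x * t) = 0" using w_nonneg[of "t * x - x * t"] by linarith
    then show ?thesis by simp
  qed
  have u_commute: "u * x = x * u" if "w x \<le> 1" for x
    using commute[OF _ _ _ that, of u] u(2) generated_commute[OF x_mem_generated] by simp
  have comm1: "t * x = x * t" if "w t \<le> 1" "w x \<le> 1" for t x
  proof (rule commute[OF that(1) _ _ that(2)])
    show tu: "t * u = u * t" using u_commute[OF that(1)] by simp
    show "t * y = y * t" if "y \<in> generated u" for y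
      using that unfolding generated_def
      by (rule commute_span) (auto intro: power_commuting_commutes[OF tu[symmetric], symmetric])
  qed
  \<comment> \<open>Elements that are not integral have integral inverses, and centralizers are
    closed under inverses.\<close>
  have comm2: "t * x = x * t" if t: "w t \<le> 1" for t x
  proof (cases "w x \<le> 1")
    case False
    then have "w (inverse x) \<le> 1" by (simp add: w_inverse inverse_le_1_iff)
    then have "inverse x \<in> cent t" using comm1[OF t] by (simp add: cent_def)
    then have "inverse (inverse x) \<in> cent t" using subdiv_cent[of t] unfolding subdiv_def by blast
    then show ?thesis by (simp add: cent_def)
  qed (rule comm1[OF t])
  have "t * x = x * t" for t x :: 'd
  proof (cases "w t \<le> 1")
    case False
    then have "w (inverse t) \<le> 1" by (simp add: w_inverse inverse_le_1_iff)
    then have "inverse t \<in> cent x" using comm2 by (simp add: cent_def)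
    then have "inverse (inverse t) \<in> cent x" using subdiv_cent[of x] unfolding subdiv_def by blast
    then show ?thesis by (simp add: cent_def)
  qed (rule comm2)
  then show False using ex_noncommuting by metis
qed

text \<open>Lagrange's root count modulo the maximal ideal, by synthetic division.\<close>
lemma w_ev_ge_1:
  assumes "finite A" "\<And>a. a \<in> A \<Longrightarrow> v (poly f (of_int a)) < 1"
    "\<And>a a'. a \<in> A \<Longrightarrow> a' \<in> A \<Longrightarrow> a \<noteq> a' \<Longrightarrow> v (of_int (a - a')) = 1"
    "lead_coeff f = 1" "degree f = card A" and u: "\<And>a::int. w (u - of_int a) \<ge> 1"
  shows "w (ev u f) \<ge> 1"
  using assms(1-5)
proof (induction A arbitrary: f rule: finite_induct)
  case empty
  then have "f = 1" by (metis card.empty degree_0_id monic_degree_0 pCons_one)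
  then show ?case by (simp add: one_pCons ev_pCons sm_one)
next
  case (insert a A)
  define g where "g = synthetic_div f (of_int a)"
  have fg: "[:- of_int a, 1:] * g + [:poly f (of_int a):] = f"
    unfolding g_def by (rule synthetic_div_correct')
  have deg: "degree g = card A" using insert by (simp add: g_def degree_synthetic_div)
  have "degree f \<noteq> 0" using insert by simp
  then have "g \<noteq> 0" unfolding g_def by (simp add: synthetic_div_eq_0_iff)
  then have "degree ([:- of_int a, 1:] * g) = degree f"
    using deg insert by (subst degree_mult_eq) auto
  then have "lead_coeff ([:- of_int a, 1:] * g) = lead_coeff f"
    using arg_cong[OF fg, of "\<lambda>h. coeff h (degree f)"] \<open>degree f \<noteq> 0\<close>
    by (simp only: coeff_add) (simp add: coeff_pCons split: nat.splits)
  then have lead: "lead_coeff g = 1" using insert by (simp only: lead_coeff_mult) simp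
  \<comment> \<open>The difference a' - a has absolute value 1, so dividing by X - a keeps a' a root
    modulo the maximal ideal.\<close>
  have "v (poly g (of_int a')) < 1" if a': "a' \<in> A" for a'
  proof -
    have "poly f (of_int a') = (of_int a' - of_int a) * poly g (of_int a') + poly f (of_int a)"
      by (subst fg[symmetric]) (simp add: algebra_simps)
    then have "of_int (a' - a) * poly g (of_int a') = poly f (of_int a') - poly f (of_int a)" by simp
    moreover have "v (poly f (of_int a') - poly f (of_int a)) < 1"
      using insert a' by - (rule v_ultra_diff_less, auto)
    moreover have "v (of_int (a' - a)) = 1" using insert a' by auto
    ultimately show ?thesis by (metis mult_1 v_mult)
  qed
  then have "w (ev u g) \<ge> 1" using insert deg lead by (intro insert.IH) auto
  then have ge: "w ((u - of_int a) * ev u g) \<ge> 1"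
    using u[of a] mult_mono[of 1 "w (u - of_int a)" 1 "w (ev u g)"] by (simp add: w_mult)
  have "ev u f = (u - of_int a) * ev u g + sm (poly f (of_int a)) 1"
  proof -
    have "ev u [:- of_int a, 1:] = u - of_int a" by (simp add: ev_pCons sm_one sm_of_int)
    moreover have "ev u [:poly f (of_int a):] = sm (poly f (of_int a)) 1" by (simp add: ev_pCons)
    ultimately show ?thesis using arg_cong[OF fg, of "ev u"] by (simp only: ev_add ev_mult)
  qed
  then have "(u - of_int a) * ev u g = ev u f - sm (poly f (of_int a)) 1" by simp
  moreover have "w (sm (poly f (of_int a)) 1) < 1"
    using insert.prems(1)[of a] by (simp add: w_sm power_l2_less_1)
  ultimately show ?case
    using ge w_ultra_diff_less[of "ev u f" 1 "sm (poly f (of_int a)) 1"] by (metis linorder_not_le)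
qed

text \<open>By Fermat the integers 1, ..., p - 1 are as many roots of X^(p-1) - 1 modulo the maximal
  ideal as its degree permits, and u is congruent to none of them.\<close>

lemma power_p_minus_1_not_close:
  assumes u: "\<And>a::int. w (u - of_int a) \<ge> 1"
  shows "w (u ^ (p - 1) - 1) \<ge> 1"
proof -
  define f :: "'k poly" where "f = monom 1 (p - 1) + (- 1)"
  have deg: "degree f = p - 1"
    unfolding f_def using p_gt_1 by (subst degree_add_eq_left) (auto simp: degree_monom_eq)
  have "w (ev u f) \<ge> 1"
  proof (rule w_ev_ge_1[where A = "{1..int p - 1}"])
    fix a assume a: "a \<in> {1..int p - 1}"
    then have "\<not> int p dvd a" by (auto dest: zdvd_imp_le)
    then show "v (poly f (of_int a)) < 1"
      using power_p_minus_1_close_to_one[OF v_of_int_eq_1] by (simp add: f_def poly_monom)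
  next
    fix a a' assume a: "a \<in> {1..int p - 1}" "a' \<in> {1..int p - 1}" "a \<noteq> a'"
    then have "\<not> int p dvd a - a'"
      using dvd_imp_le_int[of "a - a'" "int p"] by auto
    then show "v (of_int (a - a')) = 1" by (rule v_of_int_eq_1)
  next
    show "lead_coeff f = 1" unfolding deg using p_gt_1 by (simp add: f_def)
    show "degree f = card {1..int p - 1}" unfolding deg by simp
  qed (use u in auto)
  moreover have "ev u 1 = 1" by (simp add: one_pCons ev_pCons sm_one)
  moreover have "ev u f = ev u (monom 1 (p - 1)) + ev u (- 1)"
    unfolding f_def by (rule ev_add)
  moreover have "ev u (- 1) = - ev u 1" using ev_add[of u "- 1" 1] by (simp add: eq_neg_iff_add_eq_0)
  ultimately show ?thesis by (simp add: ev_monom sm_one)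
qed

section \<open>Teichmueller representatives\<close>

lemma ex_residue_order:
  assumes \<theta>: "w \<theta> = 1"
  shows "\<exists>m>0. \<not> p dvd m \<and> w (\<theta> ^ m - 1) < 1"
proof -
  \<comment> \<open>Compactness stands in for finiteness of the residue field: two members of a
    convergent subsequence of the powers of \<theta> are congruent, and their quotient is a power
    congruent to 1.\<close>
  obtain r x where r: "strict_mono (r :: nat \<Rightarrow> nat)" "dtends (\<lambda>i. \<theta> ^ r i) x"
    using ex_dtends_subseq_w[of "\<lambda>i. \<theta> ^ i"] \<theta> by (auto simp: w_power)
  have "eventually (\<lambda>i. w (\<theta> ^ r i - x) < 1) sequentially"
    using w_tends_diff[OF r(2)] by (rule order_tendstoD) simp
  then obtain i where "\<And>j. j \<ge> i \<Longrightarrow> w (\<theta> ^ r j - x) < 1" by (auto simp: eventually_sequentially)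
  then have "w ((\<theta> ^ r (Suc i) - x) - (\<theta> ^ r i - x)) < 1" by - (rule w_ultra_diff_less, auto)
  then have close: "w (\<theta> ^ r (Suc i) - \<theta> ^ r i) < 1" by simp
  have less: "r i < r (Suc i)" using r(1) by (simp add: strict_mono_def)
  define N where "N = r (Suc i) - r i"
  have "\<theta> ^ r (Suc i) - \<theta> ^ r i = \<theta> ^ r i * (\<theta> ^ N - 1)"
    using less by (simp add: N_def right_diff_distrib flip: power_add)
  then have N: "w (\<theta> ^ N - 1) < 1" "N > 0" using close less \<theta> by (simp_all add: w_mult w_power N_def)
  define m where "m = (LEAST m. m > 0 \<and> w (\<theta> ^ m - 1) < 1)"
  have m: "m > 0 \<and> w (\<theta> ^ m - 1) < 1" unfolding m_def by (rule LeastI[of _ N]) (use N in auto)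
  \<comment> \<open>Otherwise \<open>close_if_power_p_close\<close> would make m/p a smaller
    exponent.\<close>
  have "\<not> p dvd m"
  proof
    assume "p dvd m"
    then obtain m' where m': "m = m' * p" by (metis dvdE mult.commute)
    then have "w ((\<theta> ^ m') ^ p - 1) < 1" using m by (simp add: power_mult)
    then have "w (\<theta> ^ m' - 1) < 1" using \<theta> close_if_power_p_close[of "\<theta> ^ m'"] by (simp add: w_power)
    moreover have "m' > 0" using m m' by (cases m') auto
    ultimately have "m \<le> m'" unfolding m_def by (intro Least_le) auto
    then show False using m' \<open>m' > 0\<close> p_gt_1 by simp
  qed
  then show ?thesis using m by blast
qed

text \<open>The Teichmueller lift: a limit point of \<open>\<theta> ^ q ^ k\<close> for a power \<open>q\<close> of \<open>p\<close> congruent to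
  \<open>1\<close> modulo the order of the residue of \<open>\<theta>\<close>.\<close>
lemma ex_teichmueller:
  assumes \<theta>: "w \<theta> = 1" and m: "m > 0" "\<not> p dvd m" "w (\<theta> ^ m - 1) < 1"
  shows "\<exists>u. u ^ m = 1 \<and> w (u - \<theta>) < 1"
proof -
  define t where "t = totient m"
  have "coprime p m" using p m(2) by (simp add: prime_imp_coprime)
  then have cong: "[p ^ t = 1] (mod m)" unfolding t_def by (rule euler_theorem)
  have t0: "t > 0" using m(1) by (simp add: t_def)
  \<comment> \<open>Since p^t is congruent to 1 modulo m, \<open>s k\<close> is \<theta> times a
    power of \<theta>^m and stays in the residue class of \<theta>. At the same time (s_k)^m is a
    p^(t k)-th power of \<theta>^m and tends to 1.\<close>
  define s where "s k = \<theta> ^ (p ^ (t * k))" for k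
  have s1: "w (s k) = 1" for k by (simp add: s_def w_power \<theta>)
  have close: "w (s k - \<theta>) < 1" for k
  proof -
    have "[p ^ (t * k) = 1] (mod m)" using cong_pow[OF cong, of k] by (simp add: power_mult)
    moreover have "p ^ (t * k) \<ge> 1" using p_gt_1 by simp
    ultimately have "m dvd p ^ (t * k) - 1" by (simp add: cong_sym cong_altdef_nat)
    then obtain c where "p ^ (t * k) - 1 = m * c" by auto
    then have c: "p ^ (t * k) = Suc (m * c)" using \<open>p ^ (t * k) \<ge> 1\<close> by simp
    have "s k - \<theta> = \<theta> * ((\<theta> ^ m) ^ c - 1)" unfolding s_def c by (simp add: power_mult right_diff_distrib)
    then show ?thesis using w_power_close[OF m(3), of c] by (simp add: w_mult \<theta>)
  qed
  define c where "c = max (w (of_nat p)) (w (\<theta> ^ m - 1))"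
  have c: "c \<ge> 0" "c < 1" "w (of_nat p) \<le> c" "w (\<theta> ^ m - 1) \<le> c"
    using m(3) w_p_less_1 by (auto simp: c_def le_max_iff_disj)
  have pow: "w (s k ^ m - 1) \<le> c ^ k" for k
  proof -
    have "w (s k ^ m - 1) = w ((\<theta> ^ m) ^ (p ^ (t * k)) - 1)"
      by (simp add: s_def mult.commute flip: power_mult)
    also have "\<dots> \<le> c ^ Suc (t * k)" by (rule w_power_p_power_close[OF c(4,3,2)])
    also have "\<dots> \<le> c ^ k" using c t0 by (intro power_decreasing) (auto intro: le_SucI)
    finally show ?thesis .
  qed
  obtain r u where r: "strict_mono (r :: nat \<Rightarrow> nat)" "dtends (\<lambda>i. s (r i)) u"
    using ex_dtends_subseq_w[of s] s1 by auto
  have lim: "(\<lambda>i. w (s (r i) - u)) \<longlonglongrightarrow> 0" by (rule w_tends_diff[OF r(2)])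
  then have "eventually (\<lambda>i. w (s (r i) - u) < 1) sequentially" by (rule order_tendstoD) simp
  then obtain i where i: "w (s (r i) - u) < 1" by (auto simp: eventually_sequentially)
  have "w ((s (r i) - \<theta>) - (s (r i) - u)) < 1" by (rule w_ultra_diff_less[OF close i])
  then have u\<theta>: "w (u - \<theta>) < 1" by simp
  have wu: "w u \<le> 1" using w_ultra_le[of "u - \<theta>" 1 \<theta>] u\<theta> \<theta> by simp
  \<comment> \<open>The m-th power map does not increase distances on the unit ball
    (\<open>w_power_diff\<close>), so the estimate for (s_k)^m passes to the limit point.\<close>
  have "w (u ^ m - 1) \<le> 0"
  proof (rule LIMSEQ_le_const)
    have "(\<lambda>i. c ^ r i) \<longlonglongrightarrow> 0"
      using LIMSEQ_subseq_LIMSEQ[OF LIMSEQ_realpow_zero[OF c(1,2)] r(1)] by (simp add: o_def)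
    then show "(\<lambda>i. w (s (r i) - u) + c ^ r i) \<longlonglongrightarrow> 0" using lim by (intro tendsto_add_zero)
    show "\<exists>N. \<forall>i\<ge>N. w (u ^ m - 1) \<le> w (s (r i) - u) + c ^ r i"
    proof (intro exI[of _ 0] allI impI)
      fix i
      have "w (u ^ m - s (r i) ^ m) \<le> w (s (r i) - u)"
        using w_power_diff[OF wu, of "s (r i)" m] s1 w_minus_commute[of u] by simp
      moreover have "u ^ m - 1 = (u ^ m - s (r i) ^ m) + (s (r i) ^ m - 1)" by simp
      then have "w (u ^ m - 1) \<le> max (w (u ^ m - s (r i) ^ m)) (w (s (r i) ^ m - 1))"
        using w_ultra by metis
      ultimately show "w (u ^ m - 1) \<le> w (s (r i) - u) + c ^ r i"
        using pow[of "r i"] w_nonneg[of "s (r i) - u"] w_nonneg[of "s (r i) ^ m - 1"] by linarith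
    qed
  qed
  then have "w (u ^ m - 1) = 0" using w_nonneg[of "u ^ m - 1"] by linarith
  then show ?thesis using u\<theta> by auto
qed

section \<open>SL_1(D) is not a pro-p group\<close>

lemma ex_SL1_not_close: "\<exists>g\<in>G. w (g - 1) \<ge> 1"
proof -
  obtain \<theta> where \<theta>: "w \<theta> \<le> 1" "\<And>a::int. w (\<theta> - of_int a) \<ge> 1" using ex_residue_not_integer by blast
  have "w \<theta> = 1" using \<theta>(1) \<theta>(2)[of 0] by simp
  then obtain m where m: "m > 0" "\<not> p dvd m" "w (\<theta> ^ m - 1) < 1" using ex_residue_order by blast
  obtain u where u: "u ^ m = 1" "w (u - \<theta>) < 1" using ex_teichmueller[OF \<open>w \<theta> = 1\<close> m] by blast
  have "w (u - of_int a) \<ge> 1" for a :: int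
  proof (rule ccontr)
    assume "\<not> w (u - of_int a) \<ge> 1"
    then have "w ((u - of_int a) - (u - \<theta>)) < 1" using u(2) by - (rule w_ultra_diff_less, auto)
    then show False using \<theta>(2)[of a] by simp
  qed
  then have "w (u ^ (p - 1) - 1) \<ge> 1" by (rule power_p_minus_1_not_close)
  moreover have "nrm u ^ m = 1" using u(1) by (simp flip: nrm_power)
  then have "nrm u ^ (p - 1) = 1" using m by (intro root_of_unity_order_dvd)
  then have "u ^ (p - 1) \<in> G" by (simp add: SL1_iff nrm_power)
  ultimately show ?thesis by blast
qed

lemma w_SL1: "x \<in> G \<Longrightarrow> w x = 1"
  by (simp add: SL1_iff w_def)

text \<open>Continuity of w at 0, in the form that makes {x. w(x - 1) < 1} open in the sense of
  \<open>rel_open\<close>.\<close>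

lemma w_small_ball: "\<exists>e>0. \<forall>x. D_norm v sm b (l ^ 2) x < e \<longrightarrow> w x < 1"
proof (rule ccontr)
  let ?n = "l ^ 2"
  assume "\<not> ?thesis"
  then have "\<forall>e>0. \<exists>x. D_norm v sm b ?n x < e \<and> w x \<ge> 1" by (metis not_le)
  then have "\<forall>k. \<exists>x. D_norm v sm b ?n x < 1 / Suc k \<and> w x \<ge> 1" by simp
  then obtain s where s: "\<And>k. D_norm v sm b ?n (s k) < 1 / Suc k" "\<And>k. w (s k) \<ge> 1" by metis
  have "dtends s 0"
    unfolding dtends_def
  proof (intro allI impI)
    fix j assume j: "j < ?n"
    have "finite {v (coords sm b ?n (s k) i) |i. i < ?n}" for k by auto
    then have "v (coords sm b ?n (s k) j) \<le> D_norm v sm b ?n (s k)" for k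
      unfolding D_norm_def using j by (intro Max_ge) auto
    then have "v (coords sm b ?n (s k) j - 0) \<le> inverse (real (Suc k))" for k
      using s(1)[of k] by (simp only: inverse_eq_divide diff_0_right) (meson less_imp_le order_trans)
    then show "tends (\<lambda>k. coords sm b ?n (s k) j) (coords sm b ?n 0 j)"
      unfolding coords_zero using LIMSEQ_inverse_real_of_nat by (rule tends_bound)
  qed
  then have "(\<lambda>k. w (s k)) \<longlonglongrightarrow> 0" using w_tends by fastforce
  then have "eventually (\<lambda>k. w (s k) < 1) sequentially" by (rule order_tendstoD) simp
  then show False using s(2) by (auto simp: eventually_sequentially not_le[symmetric])
qed

lemma not_pro_p_SL1: "\<not> is_pro_p p v sm b (l ^ 2) G"
proof
  assume pro: "is_pro_p p v sm b (l ^ 2) G"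
  define N where "N = {x \<in> G. w (x - 1) < 1}"
  have G: "is_subgroup G G" "0 \<notin> G"
    by (auto simp: is_subgroup_def SL1_iff nrm_mult nrm_inverse)
  have Gs: "1 \<in> G" "\<And>x y. x \<in> G \<Longrightarrow> y \<in> G \<Longrightarrow> x * y \<in> G" "\<And>x. x \<in> G \<Longrightarrow> inverse x \<in> G"
    using G(1) by (auto simp: is_subgroup_def)
  have nz: "x \<noteq> 0" if "x \<in> G" for x using that G(2) by auto
  have "is_subgroup N G"
    unfolding is_subgroup_def
  proof (intro conjI ballI)
    fix x y assume x: "x \<in> N" and y: "y \<in> N"
    have "w ((x - 1) * y + (y - 1)) < 1"
      using x y w_SL1[of y] by (intro w_ultra_less) (auto simp: N_def w_mult)
    then show "x * y \<in> N" using x y Gs by (simp add: N_def algebra_simps)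
  next
    fix x assume x: "x \<in> N"
    then have "x \<noteq> 0" using nz by (auto simp: N_def)
    then have "inverse x - 1 = - (inverse x * (x - 1))" by (simp add: algebra_simps)
    then have "w (inverse x - 1) = w (x - 1)" using x w_SL1[of x] by (simp add: N_def w_mult w_inverse)
    then show "inverse x \<in> N" using x Gs by (simp add: N_def)
  qed (use Gs in \<open>auto simp: N_def\<close>)
  moreover have "g * x * inverse g \<in> N" if g: "g \<in> G" and x: "x \<in> N" for g x
  proof -
    have "g * x * inverse g - 1 = g * (x - 1) * inverse g" using nz[OF g] by (simp add: algebra_simps)
    then have "w (g * x * inverse g - 1) = w (x - 1)" using w_SL1[OF g] by (simp add: w_mult w_inverse)
    then show ?thesis using g x Gs by (simp add: N_def)
  qed
  ultimately have N: "is_normal_subgroup N G" by (auto simp: is_normal_subgroup_def)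
  obtain e where e: "e > 0" "\<And>x. D_norm v sm b (l ^ 2) x < e \<Longrightarrow> w x < 1" using w_small_ball by blast
  have "Defs.rel_open v sm b (l ^ 2) G N"
    unfolding Defs.rel_open_def
  proof (intro conjI ballI exI[of _ e] impI e(1))
    fix x y assume x: "x \<in> N" and y: "y \<in> G" "D_norm v sm b (l ^ 2) (y - x) < e"
    have "w ((y - x) + (x - 1)) < 1" using x e(2)[OF y(2)] by (intro w_ultra_less) (auto simp: N_def)
    then show "y \<in> N" using y by (simp add: N_def)
  qed (auto simp: N_def)
  then obtain k where "group_index N G = p ^ k" using pro N unfolding is_pro_p_def by blast
  then have pow: "g ^ (p ^ k) \<in> N" if "g \<in> G" for g
    using index_power_mem[OF G N _ _ that] p_gt_1 by simp
  obtain g where g: "g \<in> G" "w (g - 1) \<ge> 1" using ex_SL1_not_close by blast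
  \<comment> \<open>Index p^k puts the p^k-th power of g into N, and descending through p-th roots,
    each again congruent to 1, reaches g itself.\<close>
  have "w (g - 1) < 1"
    using pow[OF g(1)] w_SL1[OF g(1)] by (intro close_if_power_p_power_close[of g k]) (auto simp: N_def)
  then show False using g(2) by simp
qed

end

theorem theorem1p1:
  fixes p l :: nat
    and v :: "'k::field_char_0 \<Rightarrow> real"
    and sm :: "'k \<Rightarrow> 'd::division_ring \<Rightarrow> 'd"
    and b :: "nat \<Rightarrow> 'd"
  assumes "prime p" and "odd p"
    and "prime l" and "\<not> l dvd (p - 1)"
    and "is_Qp p v"
    and "is_K_algebra sm" and "is_central sm"
    and "is_basis sm b (l ^ 2)"
  shows "CSA_group (SL1 sm b (l ^ 2) l)
         \<and> \<not> is_pro_p p v sm b (l ^ 2) (SL1 sm b (l ^ 2) l)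
         \<and> \<not> is_abelian_set (SL1 sm b (l ^ 2) l)"
proof -
  interpret Qp p v by unfold_locales (use assms in auto)
  interpret padic_division_algebra p v sm b l
    by unfold_locales (use assms no_root_of_unity in auto)
  show ?thesis using CSA_SL1 not_pro_p_SL1 not_abelian_SL1 by blast
qed

end
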